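(* Let $d\ge 1$, let $\mathcal{U}$ be an oriented update family in $\mathbb{Z}^d$, let $q\in(0,1)$, $p=1-q$, and assume that $\inf_{n\ge 1}\lambda^{(n)}>0$, where $\lambda^{(n)}$ is the spectral gap of the $\mathcal{U}$-KCM on $\Lambda_n=\{1,\dots,n\}^d$ with facilitating boundary conditions. Then the mixing time of the $\mathcal{U}$-KCM on $\Lambda_n$, with facilitating boundary conditions, exhibits pre-cutoff in linear time. More precisely, there exists a constant $C=C(q,d,\mathcal{U})\ge 1$ such that, for all $\varepsilon\in(0,1)$ and all $n$ sufficiently large (depending on $\varepsilon$), $$C^{-1}n\le t_{\mathrm{mix}}^{(n)}(\varepsilon)\le Cn.$$
   Context: Update families. An update family $\mathcal{U}$ is a finite non-empty collection of finite non-empty subsets of $\mathbb{Z}^d\setminus\{0\}$. It is called oriented if there is a unit vector $v\in\mathbb{R}^d$ such that $\langle u,v\rangle<0$ for every $u\in\bigcup_{U\in\mathcal{U}}U$. Dynamics. Let $\Omega_n=\{0,1\}^{\Lambda_n}$, and let $\pi_n=\mathrm{Ber}(p)^{\otimes\Lambda_n}$ be the product measure under which each spin equals $1$ with probability $p$ and $0$ with probability $q=1-p$. Configurations $\eta\in\Omega_n$ are extended to $\mathbb{Z}^d$ by setting $\eta_y=0$ for all $y\notin\Lambda_n$ (facilitating boundary conditions). For $x\in\Lambda_n$ the constraint is $$c_x(\eta)=\mathbf{1}\{\exists U\in\mathcal{U}:\ \eta_y=0\text{ for all }y\in x+U\}.$$ The $\mathcal{U}$-KCM on $\Lambda_n$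 is the continuous-time Markov chain $(\eta(t))_{t\ge0}$ on $\Omega_n$ with generator $$\mathcal{L}_nf(\eta)=\sum_{x\in\Lambda_n}c_x(\eta)\,[\pi_x(f)(\eta)-f(\eta)],\qquad \pi_x(f)(\eta)=p f(\eta^{x\leftarrow1})+q f(\eta^{x\leftarrow0}),$$ where $\eta^{x\leftarrow i}$ is $\eta$ with the spin at $x$ replaced by $i$. It is reversible with respect to $\pi_n$. $\mathbb{P}_\eta$ denotes the law of the chain started from $\eta$. Spectral gap. $$\lambda^{(n)}=\inf_{f:\Omega_n\to\mathbb{R},\ f\neq\mathrm{const}}\frac{-\pi_n(f\mathcal{L}_nf)}{\mathrm{Var}_{\pi_n}(f)}.$$ Mixing time. $d_n(t)=\sup_{\eta\in\Omega_n}\|\mathbb{P}_\eta(\eta(t)\in\cdot)-\pi_n\|_{\mathrm{TV}}$, with $\|\mu-\nu\|_{\mathrm{TV}}=\sup_A|\mu(A)-\nu(A)|$, and $t_{\mathrm{mix}}^{(n)}(\varepsilon)=\inf\{t\ge0: d_n(t)\le\varepsilon\}$. Pre-cutoff. The sequence of chains exhibits pre-cutoff if $$\sup_{\varepsilon\in(0,1/2)}\limsup_{n\to\infty}\frac{t_{\mathrm{mix}}^{(n)}(\varepsilon)}{t_{\mathrm{mix}}^{(n)}(1-\varepsilon)}<\infty.$$ Recalled fact about the hypothesis. It is known from the literature that, for oriented $\mathcal{U}$, the assumption $\inf_n\lambda^{(n)}>0$ holds for every $q\in(q_c(\mathcal{U}),1)$, where $q_c(\mathcal{U})=\inf\{q>0:\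 \mathbb{P}_\pi(\tau_0<\infty)=1\}$, with $\pi$ the product Bernoulli measure on $\{0,1\}^{\mathbb{Z}^d}$ of parameter $1-q$ and $\tau_0$ the first time the origin is updated in the stationary infinite-volume $\mathcal{U}$-KCM on $\mathbb{Z}^d$. *)

theory Defs
  imports "HOL-Probability.Probability"
begin

section \<open>Update families\<close>

definition update_family :: "(int ^ 'd::finite) set set \<Rightarrow> bool" where
  "update_family \<U> \<longleftrightarrow> finite \<U> \<and> \<U> \<noteq> {} \<and> (\<forall>U\<in>\<U>. finite U \<and> U \<noteq> {} \<and> 0 \<notin> U)"

definition oriented :: "(int ^ 'd::finite) set set \<Rightarrow> bool" where
  "oriented \<U> \<longleftrightarrow>
     (\<exists>v::real ^ 'd. norm v = 1 \<and> (\<forall>u\<in>\<Union>\<U>. (\<chi> i. real_of_int (u $ i)) \<bullet> v < 0))"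

section \<open>The KCM on the box with facilitating boundary conditions\<close>

definition site_box :: "nat \<Rightarrow> (int ^ 'd::finite) set" where
  "site_box n = {x. \<forall>i. 1 \<le> x $ i \<and> x $ i \<le> int n}"

text \<open>
  Spins are Booleans, with \<^const>\<open>True\<close> for 1 and \<^const>\<open>False\<close> for 0. A configuration on the box is
  identified with its extension by 0 to the whole lattice, so that the facilitating boundary
  condition is part of the state space.
\<close>

type_synonym 'd config = "int ^ 'd \<Rightarrow> bool"

definition configs :: "nat \<Rightarrow> 'd::finite config set" where
  "configs n = PiE_dflt (site_box n) False (\<lambda>_. UNIV)"

definition equilibrium :: "real \<Rightarrow> nat \<Rightarrow> 'd::finite config pmf" where
  "equilibrium q n = Pi_pmf (site_box n) False (\<lambda>_. bernoulli_pmf (1 - q))"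

definition constraint :: "(int ^ 'd::finite) set set \<Rightarrow> int ^ 'd \<Rightarrow> 'd config \<Rightarrow> real" where
  "constraint \<U> x \<eta> = of_bool (\<exists>U\<in>\<U>. \<forall>y\<in>(+) x ` U. \<not> \<eta> y)"

definition resample :: "real \<Rightarrow> int ^ 'd::finite \<Rightarrow> ('d config \<Rightarrow> real) \<Rightarrow> 'd config \<Rightarrow> real" where
  "resample q x f \<eta> = (1 - q) * f (\<eta>(x := True)) + q * f (\<eta>(x := False))"

definition generator ::
  "(int ^ 'd::finite) set set \<Rightarrow> real \<Rightarrow> nat \<Rightarrow> ('d config \<Rightarrow> real) \<Rightarrow> 'd config \<Rightarrow> real" where
  "generator \<U> q n f \<eta> = (\<Sum>x\<in>site_box n. constraint \<U> x \<eta> * (resample q x f \<eta> - f \<eta>))"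

text \<open>
  The Markov semigroup \<open>exp (t L)\<close> of the continuous-time chain with generator \<open>L\<close>. The state
  space is finite, so the exponential series converges; see \<open>semigroup_summable\<close>,
  \<open>semigroup_zero\<close> and \<open>semigroup_deriv\<close> (Kolmogorov's equation) below.
\<close>

definition semigroup ::
  "(int ^ 'd::finite) set set \<Rightarrow> real \<Rightarrow> nat \<Rightarrow> real \<Rightarrow> ('d config \<Rightarrow> real) \<Rightarrow> 'd config \<Rightarrow> real" where
  "semigroup \<U> q n t f \<eta> = (\<Sum>k. t ^ k / fact k * (generator \<U> q n ^^ k) f \<eta>)"

text \<open>
  The probability that the chain started from \<open>\<eta>\<close> is in \<open>A\<close> at time \<open>t\<close>. That this is a
  probability on \<^term>\<open>configs n\<close> is shown in \<open>law_nonneg\<close>, \<open>law_configs\<close> and \<open>law_Un\<close>.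
\<close>

definition law ::
  "(int ^ 'd::finite) set set \<Rightarrow> real \<Rightarrow> nat \<Rightarrow> 'd config \<Rightarrow> real \<Rightarrow> 'd config set \<Rightarrow> real" where
  "law \<U> q n \<eta> t A = semigroup \<U> q n t (indicator A) \<eta>"

section \<open>Spectral gap, mixing time and pre-cutoff\<close>

text \<open>
  The infima below are taken in the extended reals; the infimum of the empty set is thus
  \<open>\<infinity>\<close>.
\<close>

definition spectral_gap :: "(int ^ 'd::finite) set set \<Rightarrow> real \<Rightarrow> nat \<Rightarrow> ereal" where
  "spectral_gap \<U> q n =
     (INF f\<in>{f. \<not> f constant_on configs n}.
        ereal (- measure_pmf.expectation (equilibrium q n) (\<lambda>\<eta>. f \<eta> * generator \<U> q n f \<eta>)
               / measure_pmf.variance (equilibrium q n) f))"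

definition tv_to_equilibrium ::
  "(int ^ 'd::finite) set set \<Rightarrow> real \<Rightarrow> nat \<Rightarrow> 'd config \<Rightarrow> real \<Rightarrow> real" where
  "tv_to_equilibrium \<U> q n \<eta> t =
     (SUP A\<in>Pow (configs n). \<bar>law \<U> q n \<eta> t A - measure_pmf.prob (equilibrium q n) A\<bar>)"

definition worst_tv :: "(int ^ 'd::finite) set set \<Rightarrow> real \<Rightarrow> nat \<Rightarrow> real \<Rightarrow> real" where
  "worst_tv \<U> q n t = (SUP \<eta>\<in>configs n. tv_to_equilibrium \<U> q n \<eta> t)"

definition mixing_time :: "(int ^ 'd::finite) set set \<Rightarrow> real \<Rightarrow> nat \<Rightarrow> real \<Rightarrow> ereal" where
  "mixing_time \<U> q n \<epsilon> = (INF t\<in>{t. 0 \<le> t \<and> worst_tv \<U> q n t \<le> \<epsilon>}. ereal t)"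

definition pre_cutoff :: "(nat \<Rightarrow> real \<Rightarrow> ereal) \<Rightarrow> bool" where
  "pre_cutoff tmix \<longleftrightarrow>
     (SUP \<epsilon>\<in>{0<..<1/2}. limsup (\<lambda>n. tmix n \<epsilon> / tmix n (1 - \<epsilon>))) < \<infinity>"

section \<open>The semigroup is that of a Markov chain on the configurations\<close>

lemma finite_site_box: "finite (site_box n :: (int ^ 'd::finite) set)"
proof -
  have "(site_box n :: (int ^ 'd) set) \<subseteq> vec_lambda ` PiE UNIV (\<lambda>_. {1..int n})"
  proof
    fix x :: "int ^ 'd" assume "x \<in> site_box n"
    then have "vec_nth x \<in> PiE UNIV (\<lambda>_. {1..int n})" by (auto simp: site_box_def)
    then show "x \<in> vec_lambda ` PiE UNIV (\<lambda>_. {1..int n})"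
      by (metis image_eqI vec_nth_inverse)
  qed
  then show ?thesis by (rule finite_subset) (intro finite_imageI finite_PiE; simp)
qed

lemma finite_configs: "finite (configs n :: 'd::finite config set)"
  unfolding configs_def by (intro finite_PiE_dflt finite_site_box) simp

lemma upd_in_configs: "\<eta> \<in> configs n \<Longrightarrow> x \<in> site_box n \<Longrightarrow> \<eta>(x := b) \<in> configs n"
  by (auto simp: configs_def PiE_dflt_def)

lemma generator_bound:
  fixes \<eta> :: "'d::finite config"
  assumes q: "0 \<le> q" "q \<le> 1" and f: "\<And>\<eta>. \<eta> \<in> configs n \<Longrightarrow> \<bar>f \<eta>\<bar> \<le> B" and \<eta>: "\<eta> \<in> configs n"
  shows "\<bar>generator \<U> q n f \<eta>\<bar> \<le> (2 * real (card (site_box n :: (int ^ 'd) set))) * B"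
proof -
  have B: "0 \<le> B" using f[OF \<eta>] by linarith
  have "\<bar>constraint \<U> x \<eta> * (resample q x f \<eta> - f \<eta>)\<bar> \<le> 2 * B" if x: "x \<in> site_box n" for x :: "int ^ 'd"
  proof -
    have "\<bar>resample q x f \<eta>\<bar> \<le> \<bar>(1 - q) * f (\<eta>(x := True))\<bar> + \<bar>q * f (\<eta>(x := False))\<bar>"
      unfolding resample_def by (rule abs_triangle_ineq)
    also have "\<dots> \<le> (1 - q) * B + q * B"
      using q f[OF upd_in_configs[OF \<eta> x]]
      by (intro add_mono) (auto simp: abs_mult intro!: mult_left_mono)
    finally have "\<bar>resample q x f \<eta>\<bar> \<le> B" by (simp add: algebra_simps)
    then have "\<bar>resample q x f \<eta> - f \<eta>\<bar> \<le> 2 * B" using f[OF \<eta>] by linarith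
    then show ?thesis using B by (simp add: constraint_def)
  qed
  then have "\<bar>generator \<U> q n f \<eta>\<bar> \<le> (\<Sum>x\<in>(site_box n :: (int ^ 'd) set). 2 * B)"
    unfolding generator_def by (intro order_trans[OF sum_abs] sum_mono)
  then show ?thesis by simp
qed

lemma generator_funpow_bound:
  fixes \<eta> :: "'d::finite config"
  assumes q: "0 \<le> q" "q \<le> 1" and f: "\<And>\<eta>. \<eta> \<in> configs n \<Longrightarrow> \<bar>f \<eta>\<bar> \<le> B" and \<eta>: "\<eta> \<in> configs n"
  shows "\<bar>(generator \<U> q n ^^ k) f \<eta>\<bar> \<le> (2 * real (card (site_box n :: (int ^ 'd) set))) ^ k * B"
  using \<eta>
proof (induction k arbitrary: \<eta>)
  case (Suc k)
  from generator_bound[OF q Suc.IH Suc.prems] show ?case by (simp add: mult.assoc)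
qed (use f in simp)

lemma semigroup_abs_summable:
  fixes \<eta> :: "'d::finite config"
  assumes q: "0 \<le> q" "q \<le> 1" and \<eta>: "\<eta> \<in> configs n"
  shows "summable (\<lambda>k. \<bar>t ^ k / fact k * (generator \<U> q n ^^ k) f \<eta>\<bar>)"
proof -
  define N where "N = 2 * real (card (site_box n :: (int ^ 'd) set))"
  define B where "B = (\<Sum>\<eta>\<in>configs n. \<bar>f (\<eta> :: 'd config)\<bar>)"
  have B: "\<bar>f \<eta>\<bar> \<le> B" if "\<eta> \<in> configs n" for \<eta>
    unfolding B_def by (intro member_le_sum that finite_configs) simp
  have "summable (\<lambda>k. inverse (fact k) * (\<bar>t\<bar> * N) ^ k * B)"
    by (intro summable_mult2 summable_exp)
  then show ?thesis
  proof (rule summable_comparison_test'[where N = 0])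
    fix k
    have "\<bar>t ^ k / fact k\<bar> * \<bar>(generator \<U> q n ^^ k) f \<eta>\<bar> \<le> \<bar>t ^ k / fact k\<bar> * (N ^ k * B)"
      unfolding N_def by (intro mult_left_mono generator_funpow_bound[OF q B \<eta>]) auto
    then show "norm \<bar>t ^ k / fact k * (generator \<U> q n ^^ k) f \<eta>\<bar>
        \<le> inverse (fact k) * (\<bar>t\<bar> * N) ^ k * B"
      by (simp add: abs_mult power_abs power_mult_distrib field_simps)
  qed
qed

lemma semigroup_summable:
  assumes "0 \<le> q" "q \<le> 1" and "\<eta> \<in> configs n"
  shows "summable (\<lambda>k. t ^ k / fact k * (generator \<U> q n ^^ k) f \<eta>)"
  using semigroup_abs_summable[OF assms] by (rule summable_rabs_cancel)

lemma semigroup_zero: "semigroup \<U> q n 0 f \<eta> = f \<eta>"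
proof -
  have "(\<Sum>k. 0 ^ k / fact k * (generator \<U> q n ^^ k) f \<eta>)
      = (\<Sum>k\<in>{0}. 0 ^ k / fact k * (generator \<U> q n ^^ k) f \<eta>)"
    by (rule suminf_finite) auto
  then show ?thesis by (simp add: semigroup_def)
qed

lemma semigroup_deriv:
  assumes "0 \<le> q" "q \<le> 1" and "\<eta> \<in> configs n"
  shows "((\<lambda>t. semigroup \<U> q n t f \<eta>) has_real_derivative
           semigroup \<U> q n t (generator \<U> q n f) \<eta>) (at t)"
proof -
  define c where "c k = (generator \<U> q n ^^ k) f \<eta> / fact k" for k
  have "diffs c k = (generator \<U> q n ^^ k) (generator \<U> q n f) \<eta> / fact k" for k
  proof -
    have "diffs c k = real (Suc k) * ((generator \<U> q n ^^ Suc k) f \<eta> / (real (Suc k) * fact k))"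
      by (simp only: diffs_def c_def fact_Suc of_nat_mult of_nat_fact)
    then show ?thesis
      by (simp only: funpow_Suc_right comp_def) (simp del: of_nat_Suc)
  qed
  moreover have "summable (\<lambda>k. c k * s ^ k)" for s
    using semigroup_summable[OF assms, of s \<U> f] by (simp add: c_def field_simps)
  ultimately show ?thesis
    using termdiffs_strong_converges_everywhere[of c t]
    by (simp add: semigroup_def c_def mult.commute)
qed

lemma generator_add: "generator \<U> q n (\<lambda>\<eta>. f \<eta> + g \<eta>) = (\<lambda>\<eta>. generator \<U> q n f \<eta> + generator \<U> q n g \<eta>)"
  by (rule ext) (simp add: generator_def resample_def algebra_simps sum.distrib sum_subtractf)

lemma generator_cmult: "generator \<U> q n (\<lambda>\<eta>. a * f \<eta>) = (\<lambda>\<eta>. a * generator \<U> q n f \<eta>)"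
  by (rule ext) (simp add: generator_def resample_def algebra_simps sum_distrib_left)

lemma generator_funpow_add:
  "(generator \<U> q n ^^ k) (\<lambda>\<eta>. f \<eta> + g \<eta>)
     = (\<lambda>\<eta>. (generator \<U> q n ^^ k) f \<eta> + (generator \<U> q n ^^ k) g \<eta>)"
  by (induction k) (simp_all add: generator_add)

lemma semigroup_add:
  assumes "0 \<le> q" "q \<le> 1" and "\<eta> \<in> configs n"
  shows "semigroup \<U> q n t (\<lambda>\<eta>. f \<eta> + g \<eta>) \<eta> = semigroup \<U> q n t f \<eta> + semigroup \<U> q n t g \<eta>"
  unfolding semigroup_def generator_funpow_add distrib_left
  by (intro suminf_add[symmetric] semigroup_summable assms)

lemma generator_cong:
  assumes "\<And>\<eta>. \<eta> \<in> configs n \<Longrightarrow> f \<eta> = g \<eta>" and "\<eta> \<in> configs n"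
  shows "generator \<U> q n f \<eta> = generator \<U> q n g \<eta>"
  unfolding generator_def resample_def using assms upd_in_configs
  by (intro sum.cong) (auto simp: upd_in_configs)

lemma generator_funpow_cong:
  assumes "\<And>\<eta>. \<eta> \<in> configs n \<Longrightarrow> f \<eta> = g \<eta>" and "\<eta> \<in> configs n"
  shows "(generator \<U> q n ^^ k) f \<eta> = (generator \<U> q n ^^ k) g \<eta>"
  using assms(2)
proof (induction k arbitrary: \<eta>)
  case (Suc k)
  then show ?case by (auto intro: generator_cong)
qed (use assms in simp)

lemma generator_one: "generator \<U> q n (\<lambda>_. 1) = (\<lambda>_. 0)"
  by (rule ext) (simp add: generator_def resample_def)

lemma semigroup_one: "semigroup \<U> q n t (\<lambda>_. 1) \<eta> = 1"
proof -
  have z: "(generator \<U> q n ^^ k) (\<lambda>_. 0) = (\<lambda>_. 0)" for k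
    by (induction k) (simp_all add: generator_def resample_def)
  have "(generator \<U> q n ^^ Suc k) (\<lambda>_. 1) = (\<lambda>_. 0)" for k
    by (simp only: funpow_Suc_right comp_def generator_one z)
  then have "(\<Sum>k. t ^ k / fact k * (generator \<U> q n ^^ k) (\<lambda>_. 1) \<eta>)
      = (\<Sum>k\<in>{0}. t ^ k / fact k * (generator \<U> q n ^^ k) (\<lambda>_. 1) \<eta>)"
    by (intro suminf_finite) (auto simp: gr0_conv_Suc simp del: funpow.simps)
  then show ?thesis by (simp add: semigroup_def)
qed

text \<open>
  Nonnegativity, by uniformization: \<open>K = L + N\<close> with \<open>N\<close> the number of sites preserves
  nonnegativity, and \<open>exp (t N) exp (t L) = exp (t K)\<close>.
\<close>

lemma semigroup_nonneg:
  fixes \<eta> :: "'d::finite config"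
  assumes q: "0 \<le> q" "q \<le> 1" and f: "\<And>\<eta>. \<eta> \<in> configs n \<Longrightarrow> 0 \<le> f \<eta>"
    and \<eta>: "\<eta> \<in> configs n" and t: "0 \<le> t"
  shows "0 \<le> semigroup \<U> q n t f \<eta>"
proof -
  define N where "N = real (card (site_box n :: (int ^ 'd) set))"
  define L where "L = generator \<U> q n"
  define K where "K g = (\<lambda>\<eta>. L g \<eta> + N * g \<eta>)" for g
  have K_eq: "K g \<eta> = (\<Sum>x\<in>site_box n. constraint \<U> x \<eta> * resample q x g \<eta> + (1 - constraint \<U> x \<eta>) * g \<eta>)"
    for g \<eta>
    by (simp add: K_def L_def N_def generator_def algebra_simps sum.distrib sum_subtractf)
  have K_nonneg: "0 \<le> K g \<eta>" if "\<And>\<eta>. \<eta> \<in> configs n \<Longrightarrow> 0 \<le> g \<eta>" "\<eta> \<in> configs n" for g \<eta>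
    unfolding K_eq resample_def using that q upd_in_configs[OF that(2)]
    by (intro sum_nonneg add_nonneg_nonneg mult_nonneg_nonneg) (auto simp: constraint_def)
  have Kk_nonneg: "0 \<le> (K ^^ k) f \<eta>" if "\<eta> \<in> configs n" for k \<eta>
    using that
  proof (induction k arbitrary: \<eta>)
    case (Suc k)
    then show ?case by (auto intro: K_nonneg)
  qed (use f in simp)
  have L_sum: "L (\<lambda>\<eta>. \<Sum>i\<in>I. a i * g i \<eta>) = (\<lambda>\<eta>. \<Sum>i\<in>I. a i * L (g i) \<eta>)" if "finite I"
    for I :: "nat set" and a :: "nat \<Rightarrow> real" and g
    using that
  proof (induction I rule: finite_induct)
    case empty
    then show ?case by (simp add: L_def generator_def resample_def)
  next
    case (insert i I)
    then show ?case by (simp add: L_def generator_add generator_cmult)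
  qed
  have Kk: "(K ^^ k) f = (\<lambda>\<eta>. \<Sum>i\<le>k. (real (k choose i) * N ^ (k - i)) * (L ^^ i) f \<eta>)" for k
  proof (induction k)
    case (Suc k)
    let ?c = "\<lambda>k i. real (k choose i) * N ^ (k - i)"
    have *: "(\<Sum>i\<le>k. ?c k i * (L ^^ Suc i) f \<eta>) + N * (\<Sum>i\<le>k. ?c k i * (L ^^ i) f \<eta>)
        = (\<Sum>i\<le>Suc k. ?c (Suc k) i * (L ^^ i) f \<eta>)" for \<eta>
    proof -
      have "N * (\<Sum>i\<le>k. ?c k i * (L ^^ i) f \<eta>) = (\<Sum>i\<le>k. real (k choose i) * N ^ (Suc k - i) * (L ^^ i) f \<eta>)"
        unfolding sum_distrib_left by (intro sum.cong) (auto simp: Suc_diff_le)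
      also have "\<dots> = (\<Sum>i\<le>Suc k. real (k choose i) * N ^ (Suc k - i) * (L ^^ i) f \<eta>)"
        by simp
      also have "\<dots> = N ^ Suc k * f \<eta> + (\<Sum>i\<le>k. real (k choose Suc i) * N ^ (k - i) * (L ^^ Suc i) f \<eta>)"
        by (subst sum.atMost_Suc_shift) simp
      finally have 1: "N * (\<Sum>i\<le>k. ?c k i * (L ^^ i) f \<eta>) = \<dots>" .
      have "(\<Sum>i\<le>Suc k. ?c (Suc k) i * (L ^^ i) f \<eta>)
          = N ^ Suc k * f \<eta> + (\<Sum>i\<le>k. ?c (Suc k) (Suc i) * (L ^^ Suc i) f \<eta>)"
        by (subst sum.atMost_Suc_shift) simp
      then show ?thesis
        unfolding 1 by (simp add: sum.distrib[symmetric] algebra_simps del: funpow.simps)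
    qed
    have "(K ^^ Suc k) f = (\<lambda>\<eta>. (\<Sum>i\<le>k. ?c k i * (L ^^ Suc i) f \<eta>) + N * (\<Sum>i\<le>k. ?c k i * (L ^^ i) f \<eta>))"
      by (simp add: Suc.IH K_def L_sum)
    then show ?case by (simp only: *)
  qed simp
  let ?a = "\<lambda>k. t ^ k / fact k * (L ^^ k) f \<eta>" and ?b = "\<lambda>k. (t * N) ^ k / fact k"
  have "(\<lambda>k. \<Sum>i\<le>k. ?a i * ?b (k - i)) sums ((\<Sum>k. ?a k) * (\<Sum>k. ?b k))"
  proof (rule Cauchy_product_sums)
    show "summable (\<lambda>k. norm (?a k))"
      using semigroup_abs_summable[OF q \<eta>, of t \<U> f] by (simp add: L_def)
    show "summable (\<lambda>k. norm (?b k))"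
      using summable_norm_exp[of "t * N"] by (simp add: field_simps)
  qed
  moreover have "(\<Sum>i\<le>k. ?a i * ?b (k - i)) = t ^ k / fact k * (K ^^ k) f \<eta>" for k
    unfolding Kk sum_distrib_left
  proof (intro sum.cong refl)
    fix i assume "i \<in> {..k}"
    then have i: "i \<le> k" by simp
    then have "t ^ k = t ^ i * t ^ (k - i)" by (simp add: power_add[symmetric])
    then show "?a i * ?b (k - i) = t ^ k / fact k * (real (k choose i) * N ^ (k - i) * (L ^^ i) f \<eta>)"
      using binomial_fact[OF i, where 'a = real] by (simp add: power_mult_distrib field_simps)
  qed
  ultimately have *: "(\<lambda>k. t ^ k / fact k * (K ^^ k) f \<eta>) sums (semigroup \<U> q n t f \<eta> * (\<Sum>k. ?b k))"
    by (simp add: semigroup_def L_def)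
  have "0 \<le> semigroup \<U> q n t f \<eta> * (\<Sum>k. ?b k)"
    by (rule sums_le[OF _ sums_zero *]) (use t Kk_nonneg[OF \<eta>] in simp)
  moreover have "(\<Sum>k. ?b k) = exp (t * N)" by (simp add: exp_def field_simps)
  ultimately show ?thesis by (simp add: zero_le_mult_iff)
qed

lemma law_nonneg:
  assumes "0 \<le> q" "q \<le> 1" and "\<eta> \<in> configs n" and "0 \<le> t"
  shows "0 \<le> law \<U> q n \<eta> t A"
  unfolding law_def by (rule semigroup_nonneg) (use assms in auto)

lemma law_configs:
  assumes "\<eta> \<in> configs n"
  shows "law \<U> q n \<eta> t (configs n) = 1"
proof -
  have "semigroup \<U> q n t (indicator (configs n)) \<eta> = semigroup \<U> q n t (\<lambda>_. 1) \<eta>"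
    unfolding semigroup_def
    by (intro suminf_cong arg_cong2[where f = "(*)"] refl generator_funpow_cong assms) auto
  then show ?thesis by (simp add: law_def semigroup_one)
qed

lemma law_Un:
  assumes "0 \<le> q" "q \<le> 1" and "\<eta> \<in> configs n" and "A \<inter> B = {}"
  shows "law \<U> q n \<eta> t (A \<union> B) = law \<U> q n \<eta> t A + law \<U> q n \<eta> t B"
proof -
  have "(indicator (A \<union> B) :: _ \<Rightarrow> real) = (\<lambda>\<eta>. indicator A \<eta> + indicator B \<eta>)"
    using assms(4) by (auto simp: indicator_def fun_eq_iff)
  then show ?thesis using semigroup_add[OF assms(1-3)] by (simp add: law_def)
qed

end

theory Submission
  imports Defs
begin

text \<open>
  Uniformize the chain and add a record of the sites updated so far. Once every site has been
  updated the spins are dominated by the equilibrium measure, because an updated spin is in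
  equilibrium conditionally on the evolution of the sites it may depend on. So the upper bound
  reduces to the tail of the time at which all sites have been updated.

  For a site \<open>x\<close>, restrict to the event that every site of its past cone has been updated but
  \<open>x\<close> has not, and consider the density of the spins in the cone with respect to equilibrium.
  The dynamics killed at the updates of \<open>x\<close> contracts its \<open>L\<^sup>2\<close> norm at a rate given by the
  spectral gap, and mass enters only through the last updated site \<open>z\<close> of the cone, with a density
  controlled by that of \<open>z\<close>. Weights growing exponentially along the orientation close
  this system of inequalities and cost a factor \<open>exp (O(n))\<close>, which is paid for in time \<open>O(n)\<close>.

  For the lower bound, starting from all ones, zeros spread from the boundary at bounded speed, so
  the spins near the centre are still 1 at times of order \<open>n\<close>.
\<close>

text \<open>A direct L2 argument on the whole box yields only a time of the order of the volume,
  because the density of a point mass has norm exponential in the number of sites. Here no initial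
  density is ever paid for. The record starts empty, so at time 0 a past cone contributes only if it
  has no sites. All later mass enters when some \<open>z\<close> of the cone becomes its last
  updated site. The other sites of the cone have then been updated, so those outside the past cone
  of \<open>z\<close> can be averaged out, and only the density on the smaller cone is left.
  Iterating this descends along the orientation, and heights in the box differ by O(n) only; this is
  why the weights cost exp (O(n)).

  Densities appear through duality: a bound \<open>b * nrm q n f\<close> for all nonnegative
  \<open>f\<close> that depend only on the cone says that the density there has L2 norm at most
  \<open>b\<close>. Uniformization replaces differential inequalities by inductions on the number of
  rings.\<close>

definition ignores :: "'a \<Rightarrow> (('a \<Rightarrow> bool) \<Rightarrow> 'b) \<Rightarrow> bool" where
  "ignores y f \<longleftrightarrow> (\<forall>\<eta> b. f (\<eta>(y := b)) = f \<eta>)"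

lemma ignores_upd: "ignores y f \<Longrightarrow> f (\<eta>(y := b)) = f \<eta>"
  by (simp add: ignores_def)



lemma ignores_const: "ignores y (\<lambda>_. c)"
  by (simp add: ignores_def)

lemma resample_ignored: "ignores y f \<Longrightarrow> resample q y f = f"
  by (rule ext) (simp add: resample_def ignores_upd algebra_simps)

lemma ignores_resample_same: "ignores y (resample q y f)"
  by (simp add: ignores_def resample_def)

lemma ignores_resample:
  assumes "ignores y f"
  shows "ignores y (resample q x f)"
proof (cases "x = y")
  case False
  show ?thesis
    using assms by (simp add: ignores_def resample_def fun_upd_twist[OF False[symmetric]])
qed (simp add: ignores_resample_same)

lemma resample_mult_ignored:
  assumes "ignores y f"
  shows "resample q y (\<lambda>\<eta>. f \<eta> * g \<eta>) \<eta> = f \<eta> * resample q y g \<eta>"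
  using assms by (simp add: resample_def ignores_upd algebra_simps)

lemma resample_commute: "resample q x (resample q y f) = resample q y (resample q x f)"
proof (cases "x = y")
  case False
  show ?thesis
    by (rule ext) (simp add: resample_def fun_upd_twist[OF False] algebra_simps)
qed simp

lemma resample_nonneg:
  assumes "0 \<le> q" "q \<le> 1" "\<And>\<eta>. 0 \<le> f \<eta>"
  shows "0 \<le> resample q y f \<eta>"
  using assms by (simp add: resample_def)

lemma resample_power2_le:
  assumes "0 \<le> q" "q \<le> 1"
  shows "(resample q y f \<eta>)\<^sup>2 \<le> resample q y (\<lambda>\<eta>. (f \<eta>)\<^sup>2) \<eta>"
proof -
  have "resample q y (\<lambda>\<eta>. (f \<eta>)\<^sup>2) \<eta> - (resample q y f \<eta>)\<^sup>2
      = q * (1 - q) * (f (\<eta>(y := True)) - f (\<eta>(y := False)))\<^sup>2"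
    by (simp add: resample_def power2_eq_square algebra_simps)
  also have "\<dots> \<ge> 0" using assms by simp
  finally show ?thesis by simp
qed

lemma constraint_cases: "constraint \<U> y \<eta> = 0 \<or> constraint \<U> y \<eta> = 1"
proof -
  have "of_bool b = (0::real) \<or> of_bool b = (1::real)" for b by (cases b) auto
  then show ?thesis unfolding constraint_def .
qed

lemma constraint_nonneg: "0 \<le> constraint \<U> y \<eta>" and constraint_le_one: "constraint \<U> y \<eta> \<le> 1"
  by (simp_all add: constraint_def)

lemma ignores_constraint:
  assumes "\<And>u. u \<in> \<Union>\<U> \<Longrightarrow> y \<noteq> w + u"
  shows "ignores y (constraint \<U> w)"
proof -
  have "(\<eta>(y := b)) z = \<eta> z" if "U \<in> \<U>" "z \<in> (+) w ` U" for U \<eta> b z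
    using assms that by (metis UnionI fun_upd_other imageE)
  then have "(\<exists>U\<in>\<U>. \<forall>z\<in>(+) w ` U. \<not> (\<eta>(y := b)) z) \<longleftrightarrow> (\<exists>U\<in>\<U>. \<forall>z\<in>(+) w ` U. \<not> \<eta> z)" for \<eta> b
    by (intro bex_cong ball_cong refl arg_cong[where f = Not])
  then show ?thesis by (simp only: ignores_def constraint_def simp_thms)
qed

text \<open>The effect of one ring at \<open>y\<close>. Its difference from the identity is the
  summand of \<open>generator\<close> at \<open>y\<close>, so the sum over the box is the generator
  shifted by the number of sites.\<close>

definition site_op ::
  "(int ^ 'd::finite) set set \<Rightarrow> real \<Rightarrow> int ^ 'd \<Rightarrow> ('d config \<Rightarrow> real) \<Rightarrow> 'd config \<Rightarrow> real" where
  "site_op \<U> q y f \<eta> = constraint \<U> y \<eta> * resample q y f \<eta> + (1 - constraint \<U> y \<eta>) * f \<eta>"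

lemma site_op_ignored: "ignores y f \<Longrightarrow> site_op \<U> q y f = f"
  by (rule ext) (simp add: site_op_def resample_ignored algebra_simps)

section \<open>Means under the equilibrium measure\<close>

abbreviation mean :: "real \<Rightarrow> nat \<Rightarrow> ('d::finite config \<Rightarrow> real) \<Rightarrow> real" where
  "mean q n f \<equiv> measure_pmf.expectation (equilibrium q n) f"

lemma set_equilibrium: "set_pmf (equilibrium q n :: 'd::finite config pmf) \<subseteq> configs n"
  unfolding equilibrium_def configs_def
  using set_Pi_pmf_subset'[OF finite_site_box] by (fastforce simp: PiE_dflt_def)

lemma integrable_equilibrium [simp]:
  "integrable (measure_pmf (equilibrium q n :: 'd::finite config pmf)) (f :: 'd config \<Rightarrow> real)"
  by (rule integrable_measure_pmf_finite) (rule finite_subset[OF set_equilibrium finite_configs])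

lemma mean_mono: "(\<And>\<eta>. f \<eta> \<le> g \<eta>) \<Longrightarrow> mean q n f \<le> mean q n g"
  by (rule integral_mono) auto

lemma mean_const_on_configs:
  fixes f :: "'d::finite config \<Rightarrow> real"
  assumes "\<And>\<eta>. \<eta> \<in> configs n \<Longrightarrow> f \<eta> = c"
  shows "mean q n f = c"
proof -
  have "mean q n f = mean q n (\<lambda>_ :: 'd config. c)"
    by (rule integral_cong_AE) (use assms set_equilibrium in \<open>auto simp: AE_measure_pmf_iff\<close>)
  then show ?thesis by simp
qed

text \<open>Splitting off the factor at \<open>x\<close> of the product measure shows that
  \<open>f\<close> enters its mean only through its average over the spin at \<open>x\<close>, and
  averaging twice changes nothing.\<close>

lemma mean_resample:
  fixes f :: "'d::finite config \<Rightarrow> real"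
  assumes q: "0 \<le> q" "q \<le> 1" and x: "x \<in> site_box n"
  shows "mean q n (resample q x f) = mean q n f"
proof -
  define A :: "(int ^ 'd) set" where "A = site_box n - {x}"
  define P where "P = Pi_pmf A False (\<lambda>_. bernoulli_pmf (1 - q))"
  have A: "finite A" "x \<notin> A" "site_box n = insert x A"
    using x finite_site_box by (auto simp: A_def)
  have "set_pmf P \<subseteq> PiE_dflt A False (\<lambda>_. UNIV)"
    unfolding P_def using set_Pi_pmf_subset'[OF A(1)] by (fastforce simp: PiE_dflt_def)
  then have finP: "finite (set_pmf P)"
    by (rule finite_subset) (auto intro: A(1))
  have intP: "integrable (measure_pmf P) g" for g :: "'d config \<Rightarrow> real"
    by (rule integrable_measure_pmf_finite[OF finP])
  have key: "mean q n g = measure_pmf.expectation P (resample q x g)" for g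
  proof -
    have "equilibrium q n = bernoulli_pmf (1 - q) \<bind> (\<lambda>b. map_pmf (\<lambda>\<eta>. \<eta>(x := b)) P)"
      unfolding equilibrium_def A(3) P_def map_pmf_def by (rule Pi_pmf_insert'[OF A(1,2)])
    then have "mean q n g =
        measure_pmf.expectation (bernoulli_pmf (1 - q) \<bind> (\<lambda>b. map_pmf (\<lambda>\<eta>. \<eta>(x := b)) P)) g"
      by simp
    also have "\<dots> = (\<Sum>b\<in>UNIV. pmf (bernoulli_pmf (1 - q)) b *
        measure_pmf.expectation P (\<lambda>\<eta>. g (\<eta>(x := b))))"
      by (subst pmf_expectation_bind[of UNIV]) (use finP in auto)
    finally show ?thesis
      using q intP by (simp add: UNIV_bool resample_def[abs_def])
  qed
  have "resample q x (resample q x f) = resample q x f"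
    by (simp add: resample_ignored ignores_resample_same)
  then show ?thesis by (simp add: key)
qed

lemma mean_square_resample_le:
  assumes "0 \<le> q" "q \<le> 1" "x \<in> site_box n"
  shows "mean q n (\<lambda>\<eta>. (resample q x f \<eta>)\<^sup>2) \<le> mean q n (\<lambda>\<eta>. (f \<eta>)\<^sup>2)"
proof -
  have "mean q n (\<lambda>\<eta>. (resample q x f \<eta>)\<^sup>2) \<le> mean q n (resample q x (\<lambda>\<eta>. (f \<eta>)\<^sup>2))"
    using assms by (intro mean_mono resample_power2_le)
  then show ?thesis using assms by (simp add: mean_resample)
qed

text \<open>Each site operator is an orthogonal projection in \<open>L\<^sup>2\<close> of the equilibrium measure.\<close>

lemma mean_site_op_square:
  assumes "0 \<le> q" "q \<le> 1" "y \<in> site_box n" and c: "ignores y (constraint \<U> y)"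
  shows "mean q n (\<lambda>\<eta>. (site_op \<U> q y f \<eta>)\<^sup>2) = mean q n (\<lambda>\<eta>. f \<eta> * site_op \<U> q y f \<eta>)"
proof -
  let ?c = "constraint \<U> y" and ?r = "resample q y f"
  have sq: "(\<lambda>\<eta>. (site_op \<U> q y f \<eta>)\<^sup>2) = (\<lambda>\<eta>. ?c \<eta> * ?r \<eta> * ?r \<eta> + (1 - ?c \<eta>) * (f \<eta>)\<^sup>2)"
  proof
    fix \<eta> show "(site_op \<U> q y f \<eta>)\<^sup>2 = ?c \<eta> * ?r \<eta> * ?r \<eta> + (1 - ?c \<eta>) * (f \<eta>)\<^sup>2"
      using constraint_cases[of \<U> y \<eta>] by (auto simp: site_op_def power2_eq_square)
  qed
  have "resample q y (\<lambda>\<eta>. (?c \<eta> * ?r \<eta>) * f \<eta>) = (\<lambda>\<eta>. (?c \<eta> * ?r \<eta>) * ?r \<eta>)"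
    using c ignores_resample_same[of y q f]
    by (intro ext resample_mult_ignored) (simp add: ignores_def)
  then have "mean q n (\<lambda>\<eta>. (?c \<eta> * ?r \<eta>) * f \<eta>) = mean q n (\<lambda>\<eta>. ?c \<eta> * ?r \<eta> * ?r \<eta>)"
    using mean_resample[OF assms(1-3), of "\<lambda>\<eta>. (?c \<eta> * ?r \<eta>) * f \<eta>"] by simp
  moreover have "(\<lambda>\<eta>. f \<eta> * site_op \<U> q y f \<eta>) = (\<lambda>\<eta>. ?c \<eta> * ?r \<eta> * f \<eta> + (1 - ?c \<eta>) * (f \<eta>)\<^sup>2)"
    by (rule ext) (simp add: site_op_def power2_eq_square algebra_simps)
  ultimately show ?thesis unfolding sq by simp
qed

section \<open>Contraction of the killed dynamics\<close>

text \<open>At \<open>x\<close> only the illegal rings survive, so mass is lost exactly at the legal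
  updates of \<open>x\<close>: this is the evolution as long as \<open>x\<close> has not been
  updated.\<close>

definition killed_op ::
  "(int ^ 'd::finite) set set \<Rightarrow> real \<Rightarrow> nat \<Rightarrow> int ^ 'd \<Rightarrow> ('d config \<Rightarrow> real) \<Rightarrow> 'd config \<Rightarrow> real" where
  "killed_op \<U> q n x f \<eta> =
     (1 - constraint \<U> x \<eta>) * f \<eta> + (\<Sum>y\<in>site_box n - {x}. site_op \<U> q y f \<eta>)"

text \<open>The spectral gap without a quotient, so that functions of variance 0 are covered as
  well.\<close>

definition poincare :: "(int ^ 'd::finite) set set \<Rightarrow> real \<Rightarrow> nat \<Rightarrow> real \<Rightarrow> bool" where
  "poincare \<U> q n \<gamma> \<longleftrightarrow> (\<forall>g. \<gamma> * measure_pmf.variance (equilibrium q n) g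
      \<le> - mean q n (\<lambda>\<eta>. g \<eta> * generator \<U> q n g \<eta>))"

text \<open>
  The Dirichlet form of the dynamics killed at the updates of \<open>x\<close> is, up to the factor
  \<open>q (1 - q)\<close>, the original Dirichlet form evaluated at \<open>f\<close> times the centred spin at \<open>x\<close>.
\<close>

lemma mean_square_killed_op_le:
  fixes f :: "'d::finite config \<Rightarrow> real"
  assumes q: "0 < q" "q < 1" and x: "x \<in> site_box n"
    and gap: "poincare \<U> q n \<gamma>"
    and self: "\<And>y. ignores y (constraint \<U> y)"
    and fx: "ignores x f"
    and lower: "\<And>y. y \<in> site_box n \<Longrightarrow> y \<noteq> x \<Longrightarrow> ignores x (constraint \<U> y) \<or> ignores y f"
  defines "N \<equiv> real (card (site_box n :: (int ^ 'd) set))"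
  shows "mean q n (\<lambda>\<eta>. (killed_op \<U> q n x f \<eta>)\<^sup>2) \<le> N * (N - \<gamma>) * mean q n (\<lambda>\<eta>. (f \<eta>)\<^sup>2)"
proof -
  have q': "0 \<le> q" "q \<le> 1" using q by auto
  define h :: "'d config \<Rightarrow> real" where "h \<eta> = of_bool (\<eta> x) - (1 - q)" for \<eta>
  define g where "g = (\<lambda>\<eta>. f \<eta> * h \<eta>)"
  define a where "a y \<eta> = (if y = x then (1 - constraint \<U> x \<eta>) * f \<eta> else site_op \<U> q y f \<eta>)" for y \<eta>
  have h0: "resample q x h = (\<lambda>_. 0)" and h2: "resample q x (\<lambda>\<eta>. (h \<eta>)\<^sup>2) = (\<lambda>_. q * (1 - q))"
    by (rule ext, simp add: resample_def h_def power2_eq_square algebra_simps)+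
  have hy: "ignores y h" if "y \<noteq> x" for y using that by (simp add: ignores_def h_def)
  have mean_h2: "mean q n (\<lambda>\<eta>. F \<eta> * (h \<eta>)\<^sup>2) = q * (1 - q) * mean q n F" if "ignores x F" for F
  proof -
    have "mean q n (\<lambda>\<eta>. F \<eta> * (h \<eta>)\<^sup>2) = mean q n (resample q x (\<lambda>\<eta>. F \<eta> * (h \<eta>)\<^sup>2))"
      using mean_resample[OF q' x] by simp
    also have "resample q x (\<lambda>\<eta>. F \<eta> * (h \<eta>)\<^sup>2) = (\<lambda>\<eta>. F \<eta> * (q * (1 - q)))"
      by (rule ext) (simp add: resample_mult_ignored[OF that] h2)
    finally show ?thesis by simp
  qed
  have rxg: "resample q x g = (\<lambda>_. 0)"
    unfolding g_def by (rule ext) (simp add: resample_mult_ignored[OF fx] h0)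
  have mean_g: "mean q n g = 0"
    using mean_resample[OF q' x, of g] by (simp add: rxg)
  have g2: "(\<lambda>\<eta>. (g \<eta>)\<^sup>2) = (\<lambda>\<eta>. (f \<eta>)\<^sup>2 * (h \<eta>)\<^sup>2)"
    by (simp add: g_def power_mult_distrib)
  have "mean q n (\<lambda>\<eta>. (g \<eta>)\<^sup>2) = q * (1 - q) * mean q n (\<lambda>\<eta>. (f \<eta>)\<^sup>2)"
    unfolding g2 using fx by (intro mean_h2) (simp add: ignores_def)
  then have var: "measure_pmf.variance (equilibrium q n) g = q * (1 - q) * mean q n (\<lambda>\<eta>. (f \<eta>)\<^sup>2)"
    by (simp add: mean_g)
  \<comment> \<open>Three cases: at \<open>x\<close> resampling annihilates \<open>g\<close>; if
    \<open>f\<close> ignores \<open>y\<close>, both sides vanish; otherwise the constraint at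
    \<open>y\<close> does not read the spin at \<open>x\<close>, so the factor \<open>h\<close> can
    be integrated out.\<close>
  have site: "mean q n (\<lambda>\<eta>. g \<eta> * (constraint \<U> y \<eta> * (resample q y g \<eta> - g \<eta>)))
      = - (q * (1 - q)) * mean q n (\<lambda>\<eta>. (f \<eta>)\<^sup>2 - f \<eta> * a y \<eta>)" if y: "y \<in> site_box n" for y
  proof (cases "y = x")
    case True
    have "mean q n (\<lambda>\<eta>. g \<eta> * (constraint \<U> y \<eta> * (resample q y g \<eta> - g \<eta>)))
        = mean q n (\<lambda>\<eta>. (- constraint \<U> x \<eta> * (f \<eta>)\<^sup>2) * (h \<eta>)\<^sup>2)"
      by (simp add: True rxg) (simp add: g_def power2_eq_square algebra_simps)
    also have "\<dots> = q * (1 - q) * mean q n (\<lambda>\<eta>. - constraint \<U> x \<eta> * (f \<eta>)\<^sup>2)"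
      using fx self[of x] by (intro mean_h2) (simp add: ignores_def)
    finally show ?thesis
      by (simp add: True a_def power2_eq_square algebra_simps)
  next
    case False
    have rg: "resample q y g \<eta> = h \<eta> * resample q y f \<eta>" for \<eta>
      using resample_mult_ignored[OF hy[OF False], of q f \<eta>] by (simp add: g_def mult.commute)
    show ?thesis
    proof (cases "ignores y f")
      case True
      have "resample q y g = g"
        by (rule ext, unfold rg resample_ignored[OF True]) (simp add: g_def)
      moreover have "a y = f"
        using False True by (simp add: fun_eq_iff a_def site_op_ignored)
      ultimately show ?thesis by (simp add: power2_eq_square)
    next
      case noty: False
      then have c: "ignores x (constraint \<U> y)" using lower[OF y False] by blast
      have "mean q n (\<lambda>\<eta>. g \<eta> * (constraint \<U> y \<eta> * (resample q y g \<eta> - g \<eta>)))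
          = mean q n (\<lambda>\<eta>. (constraint \<U> y \<eta> * f \<eta> * (resample q y f \<eta> - f \<eta>)) * (h \<eta>)\<^sup>2)"
        unfolding rg by (simp add: g_def power2_eq_square algebra_simps)
      also have "\<dots> = q * (1 - q) * mean q n (\<lambda>\<eta>. constraint \<U> y \<eta> * f \<eta> * (resample q y f \<eta> - f \<eta>))"
        using fx c ignores_resample[OF fx, of q y] by (intro mean_h2) (simp add: ignores_def)
      also have "(\<lambda>\<eta>. constraint \<U> y \<eta> * f \<eta> * (resample q y f \<eta> - f \<eta>))
          = (\<lambda>\<eta>. - ((f \<eta>)\<^sup>2 - f \<eta> * a y \<eta>))"
        using False by (simp add: a_def site_op_def power2_eq_square algebra_simps)
      finally show ?thesis by (simp add: algebra_simps)
    qed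
  qed
  have "mean q n (\<lambda>\<eta>. g \<eta> * generator \<U> q n g \<eta>)
      = (\<Sum>y\<in>site_box n. mean q n (\<lambda>\<eta>. g \<eta> * (constraint \<U> y \<eta> * (resample q y g \<eta> - g \<eta>))))"
    unfolding generator_def sum_distrib_left by (rule Bochner_Integration.integral_sum) simp
  also have "\<dots> = - (q * (1 - q)) * (\<Sum>y\<in>site_box n. mean q n (\<lambda>\<eta>. (f \<eta>)\<^sup>2 - f \<eta> * a y \<eta>))"
    unfolding sum_distrib_left by (intro sum.cong refl site)
  finally have "q * (1 - q) * (\<gamma> * mean q n (\<lambda>\<eta>. (f \<eta>)\<^sup>2))
      \<le> q * (1 - q) * (\<Sum>y\<in>site_box n. mean q n (\<lambda>\<eta>. (f \<eta>)\<^sup>2 - f \<eta> * a y \<eta>))"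
    using gap[unfolded poincare_def, rule_format, of g] unfolding var by (simp add: algebra_simps)
  then have "\<gamma> * mean q n (\<lambda>\<eta>. (f \<eta>)\<^sup>2) \<le> (\<Sum>y\<in>site_box n. mean q n (\<lambda>\<eta>. (f \<eta>)\<^sup>2 - f \<eta> * a y \<eta>))"
    using q by simp
  also have "\<dots> = N * mean q n (\<lambda>\<eta>. (f \<eta>)\<^sup>2) - (\<Sum>y\<in>site_box n. mean q n (\<lambda>\<eta>. f \<eta> * a y \<eta>))"
    by (simp add: sum_subtractf N_def)
  finally have form: "(\<Sum>y\<in>site_box n. mean q n (\<lambda>\<eta>. f \<eta> * a y \<eta>)) \<le> (N - \<gamma>) * mean q n (\<lambda>\<eta>. (f \<eta>)\<^sup>2)"
    by (simp add: algebra_simps)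
  have proj: "mean q n (\<lambda>\<eta>. (a y \<eta>)\<^sup>2) = mean q n (\<lambda>\<eta>. f \<eta> * a y \<eta>)" if "y \<in> site_box n" for y
  proof (cases "y = x")
    case True
    have "(a y \<eta>)\<^sup>2 = f \<eta> * a y \<eta>" for \<eta>
      using constraint_cases[of \<U> x \<eta>] by (auto simp: a_def True power2_eq_square)
    then show ?thesis by simp
  next
    case False
    then show ?thesis using mean_site_op_square[OF q' that self] by (simp add: a_def)
  qed
  have kill: "killed_op \<U> q n x f \<eta> = (\<Sum>y\<in>site_box n. a y \<eta>)" for \<eta>
    unfolding killed_op_def sum.remove[OF finite_site_box x] by (auto simp: a_def intro!: sum.cong)
  \<comment> \<open>Cauchy-Schwarz over the \<open>N\<close> sites together with \<open>proj\<close>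
    turns the bound on the quadratic form into a bound on the norm, without spectral theory.\<close>
  have "mean q n (\<lambda>\<eta>. (killed_op \<U> q n x f \<eta>)\<^sup>2) \<le> mean q n (\<lambda>\<eta>. N * (\<Sum>y\<in>site_box n. (a y \<eta>)\<^sup>2))"
    unfolding kill N_def
    using sum_squared_le_sum_of_squares[of "\<lambda>y. a y _" "site_box n"]
    by (intro mean_mono) (simp add: mult.commute)
  also have "\<dots> = N * (\<Sum>y\<in>site_box n. mean q n (\<lambda>\<eta>. f \<eta> * a y \<eta>))"
    by (simp add: proj)
  also have "\<dots> \<le> N * ((N - \<gamma>) * mean q n (\<lambda>\<eta>. (f \<eta>)\<^sup>2))"
    using form by (intro mult_left_mono) (auto simp: N_def)
  finally show ?thesis by (simp add: mult.assoc)
qed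

section \<open>Algebra of resampling and functions of no site\<close>

lemma resample_add: "resample q y (\<lambda>\<eta>. f \<eta> + g \<eta>) \<eta> = resample q y f \<eta> + resample q y g \<eta>"
  by (simp add: resample_def algebra_simps)

lemma resample_diff: "resample q y (\<lambda>\<eta>. f \<eta> - g \<eta>) \<eta> = resample q y f \<eta> - resample q y g \<eta>"
  by (simp add: resample_def algebra_simps)

lemma resample_sum: "resample q y (\<lambda>\<eta>. \<Sum>i\<in>I. f i \<eta>) \<eta> = (\<Sum>i\<in>I. resample q y (f i) \<eta>)"
  by (simp add: resample_def sum_distrib_left sum.distrib)

lemma resample_mono:
  assumes "0 \<le> q" "q \<le> 1" "\<And>\<eta>. f \<eta> \<le> g \<eta>"
  shows "resample q y f \<eta> \<le> resample q y g \<eta>"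
  using assms by (simp add: resample_def add_mono mult_left_mono)

lemma ignores_all_sites:
  assumes "finite A" and "\<And>y. y \<in> A \<Longrightarrow> ignores y f"
  shows "f (\<lambda>z. z \<notin> A \<and> \<eta> z) = f \<eta>"
  using assms
proof (induction A rule: finite_induct)
  case (insert y A)
  have "(\<lambda>z. z \<notin> insert y A \<and> \<eta> z) = (\<lambda>z. z \<notin> A \<and> \<eta> z)(y := False)"
    by (auto simp: fun_eq_iff)
  moreover have "ignores y f" using insert.prems by simp
  ultimately have "f (\<lambda>z. z \<notin> insert y A \<and> \<eta> z) = f (\<lambda>z. z \<notin> A \<and> \<eta> z)"
    by (simp only: ignores_upd)
  with insert show ?case by simp
qed simp

lemma ignores_all_sites_const:
  assumes "\<And>y. y \<in> site_box n \<Longrightarrow> ignores y f" and "\<eta> \<in> configs n"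
  shows "f \<eta> = f (\<lambda>_. False)"
proof -
  have "(\<lambda>z. z \<notin> site_box n \<and> \<eta> z) = (\<lambda>_. False)"
    using assms(2) by (auto simp: configs_def PiE_dflt_def fun_eq_iff)
  then show ?thesis
    using ignores_all_sites[of "site_box n" f \<eta>] finite_site_box assms(1) by metis
qed

section \<open>The dynamics with a record of the updated sites\<close>

definition unif_op ::
  "(int ^ 'd::finite) set set \<Rightarrow> real \<Rightarrow> nat \<Rightarrow> ('d config \<Rightarrow> real) \<Rightarrow> 'd config \<Rightarrow> real" where
  "unif_op \<U> q n f \<eta> = (\<Sum>y\<in>site_box n. site_op \<U> q y f \<eta>)"

text \<open>A legal ring puts \<open>y\<close> into the record even if the spin keeps its value:
  what matters is that it has been drawn afresh. The sum is not divided by the number of sites, so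
  total mass grows by that factor at each step.\<close>

definition record_op ::
  "(int ^ 'd::finite) set set \<Rightarrow> real \<Rightarrow> nat \<Rightarrow> ('d config \<Rightarrow> (int ^ 'd) set \<Rightarrow> real)
     \<Rightarrow> 'd config \<Rightarrow> (int ^ 'd) set \<Rightarrow> real" where
  "record_op \<U> q n F \<eta> S = (\<Sum>y\<in>site_box n.
     constraint \<U> y \<eta> * resample q y (\<lambda>\<eta>'. F \<eta>' (insert y S)) \<eta> + (1 - constraint \<U> y \<eta>) * F \<eta> S)"

text \<open>Chains of steps may leave the box in between; only the end point must lie in it. This
  makes the recursion over the first step available at all points of the lattice.\<close>

definition past_cone :: "(int ^ 'd::finite) set set \<Rightarrow> nat \<Rightarrow> int ^ 'd \<Rightarrow> (int ^ 'd) set" where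
  "past_cone \<U> n x = {z \<in> site_box n. (x, z) \<in> {(a, a + u) | a u. u \<in> \<Union>\<U>}\<^sup>+}"

text \<open>Constraints of sites in \<open>B\<close> read no box site outside \<open>B\<close>, so
  the spins in \<open>B\<close> evolve autonomously.\<close>

definition lower_set :: "(int ^ 'd::finite) set set \<Rightarrow> nat \<Rightarrow> (int ^ 'd) set \<Rightarrow> bool" where
  "lower_set \<U> n B \<longleftrightarrow> B \<subseteq> site_box n \<and> (\<forall>w\<in>B. \<forall>u\<in>\<Union>\<U>. w + u \<in> site_box n \<longrightarrow> w + u \<in> B)"

definition nrm :: "real \<Rightarrow> nat \<Rightarrow> ('d::finite config \<Rightarrow> real) \<Rightarrow> real" where
  "nrm q n f = sqrt (mean q n (\<lambda>\<eta>. (f \<eta>)\<^sup>2))"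

lemma lower_set_past_cone: "lower_set \<U> n (past_cone \<U> n x)"
  unfolding lower_set_def past_cone_def by (auto intro: trancl_into_trancl)

lemma finite_lower_set: "lower_set \<U> n B \<Longrightarrow> finite B"
  unfolding lower_set_def using finite_site_box finite_subset by blast

lemma past_cone_trans: "z \<in> past_cone \<U> n x \<Longrightarrow> past_cone \<U> n z \<subseteq> past_cone \<U> n x"
  unfolding past_cone_def by (auto intro: trancl_trans)

lemma step_in_past_cone: "u \<in> \<Union>\<U> \<Longrightarrow> x + u \<in> site_box n \<Longrightarrow> x + u \<in> past_cone \<U> n x"
  unfolding past_cone_def by blast

lemma past_cone_subset: "past_cone \<U> n x \<subseteq> site_box n"
  by (auto simp: past_cone_def)

lemma lower_set_insert_past_cone: "x \<in> site_box n \<Longrightarrow> lower_set \<U> n (insert x (past_cone \<U> n x))"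
  using lower_set_past_cone[of \<U> n x] past_cone_subset[of \<U> n x] step_in_past_cone[of _ \<U> x n]
  unfolding lower_set_def by blast

lemma past_cone_decreasing:
  fixes h :: "int ^ 'd::finite \<Rightarrow> real"
  assumes h: "\<And>w u. u \<in> \<Union>\<U> \<Longrightarrow> h (w + u) < h w" and "z \<in> past_cone \<U> n x"
  shows "h z < h x"
proof -
  have "(x, z) \<in> {(a, a + u) | a u. u \<in> \<Union>\<U>}\<^sup>+" using assms(2) by (simp add: past_cone_def)
  then show ?thesis
  proof (induction rule: trancl_induct)
    case (step b c)
    then obtain u where "u \<in> \<Union>\<U>" "c = b + u" by blast
    with step.IH h[of u b] show ?case by simp
  qed (use h in blast)
qed

lemma nrm_nonneg: "0 \<le> nrm q n f"
  by (simp add: nrm_def)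

lemma nrm_resample_le: "0 \<le> q \<Longrightarrow> q \<le> 1 \<Longrightarrow> x \<in> site_box n \<Longrightarrow> nrm q n (resample q x f) \<le> nrm q n f"
  by (simp add: nrm_def mean_square_resample_le)

section \<open>The recorded chain from a fixed starting configuration\<close>

locale oriented_kcm =
  fixes \<U> :: "(int ^ 'd::finite) set set" and q :: real and n :: nat
    and height :: "int ^ 'd \<Rightarrow> real" and start :: "'d config" and vol :: real
  assumes q: "0 < q" "q < 1"
    and vol: "vol = real (card (site_box n :: (int ^ 'd) set))"
    and height: "\<And>w u. u \<in> \<Union>\<U> \<Longrightarrow> height (w + u) < height w"
    and start: "start \<in> configs n"
begin

lemma q': "0 \<le> q" "q \<le> 1"
  using q by auto

abbreviation \<Lambda> :: "(int ^ 'd) set" where "\<Lambda> \<equiv> site_box n"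



text \<open>The unnormalised expectation of \<open>F\<close> after \<open>k\<close> rings, with
  total mass \<open>vol ^ k\<close>. The record is empty at the start.\<close>

definition ev :: "nat \<Rightarrow> ('d config \<Rightarrow> (int ^ 'd) set \<Rightarrow> real) \<Rightarrow> real" where
  "ev k F = (record_op \<U> q n ^^ k) F start {}"

lemma ev_0: "ev 0 F = F start {}"
  by (simp add: ev_def)

lemma ev_Suc: "ev (Suc k) F = ev k (record_op \<U> q n F)"
  by (simp add: ev_def funpow_Suc_right del: funpow.simps)

lemma ev_mono:
  assumes "\<And>\<eta> S. F \<eta> S \<le> G \<eta> S"
  shows "ev k F \<le> ev k G"
  using assms
proof (induction k arbitrary: F G)
  case (Suc k)
  have "record_op \<U> q n F \<eta> S \<le> record_op \<U> q n G \<eta> S" for \<eta> S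
    unfolding record_op_def
    by (intro sum_mono add_mono mult_left_mono resample_mono q' Suc.prems)
      (simp_all add: constraint_nonneg constraint_le_one)
  then show ?case unfolding ev_Suc by (rule Suc.IH)
qed (simp add: ev_0)

lemma ev_add: "ev k (\<lambda>\<eta> S. F \<eta> S + G \<eta> S) = ev k F + ev k G"
proof (induction k arbitrary: F G)
  case (Suc k)
  have "record_op \<U> q n (\<lambda>\<eta> S. F \<eta> S + G \<eta> S) = (\<lambda>\<eta> S. record_op \<U> q n F \<eta> S + record_op \<U> q n G \<eta> S)"
    by (intro ext) (simp add: record_op_def resample_add algebra_simps sum.distrib sum_subtractf)
  then show ?case by (simp add: ev_Suc Suc.IH vol)
qed (simp add: ev_0)

lemma ev_zero: "ev k (\<lambda>_ _. 0) = 0"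
  using ev_add[of k "\<lambda>_ _. 0" "\<lambda>_ _. 0"] by simp

lemma ev_sum: "finite I \<Longrightarrow> ev k (\<lambda>\<eta> S. \<Sum>i\<in>I. F i \<eta> S) = (\<Sum>i\<in>I. ev k (F i))"
  by (induction I rule: finite_induct) (simp_all add: ev_zero ev_add)

lemma ev_spins: "ev k (\<lambda>\<eta> S. f \<eta>) = (unif_op \<U> q n ^^ k) f start"
proof (induction k arbitrary: f)
  case (Suc k)
  have "record_op \<U> q n (\<lambda>\<eta> S. f \<eta>) = (\<lambda>\<eta> S. unif_op \<U> q n f \<eta>)"
    by (intro ext) (simp add: record_op_def unif_op_def site_op_def)
  then show ?case by (simp add: ev_Suc Suc.IH funpow_Suc_right del: funpow.simps)
qed (simp add: ev_0)



lemma height_past_cone: "z \<in> past_cone \<U> n x \<Longrightarrow> height z < height x"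
  using past_cone_decreasing[where h = height, OF height] .

lemma self_ignores: "ignores y (constraint \<U> y)"
  by (rule ignores_constraint) (use height[of _ y] in force)

lemma lower_ignores:
  assumes "lower_set \<U> n B" "w \<in> B" "y \<in> \<Lambda> - B"
  shows "ignores y (constraint \<U> w)"
  using assms by (intro ignores_constraint) (auto simp: lower_set_def)

text \<open>
  Conditionally on the evolution of the sites that do not depend on \<open>y\<close>, an updated spin at \<open>y\<close>
  is in equilibrium; hence functions that vanish unless \<open>y\<close> has been updated and have mean zero
  in the spin at \<open>y\<close> have mean zero at all times.
\<close>

lemma ev_updated_centred:
  assumes B: "lower_set \<U> n B" and y: "y \<in> B" and top: "\<And>w u. w \<in> B \<Longrightarrow> u \<in> \<Union>\<U> \<Longrightarrow> y \<noteq> w + u"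
    and "\<And>\<eta> S. y \<notin> S \<Longrightarrow> G \<eta> S = 0"
    and "\<And>\<eta> S. resample q y (\<lambda>\<eta>. G \<eta> S) \<eta> = 0"
    and "\<And>z S. z \<in> \<Lambda> - B \<Longrightarrow> ignores z (\<lambda>\<eta>. G \<eta> S)"
    and "\<And>z \<eta> S. z \<in> \<Lambda> - B \<Longrightarrow> G \<eta> (insert z S) = G \<eta> S"
  shows "ev k G = 0"
  using assms(4-7)
proof (induction k arbitrary: G)
  case 0
  then show ?case by (simp add: ev_0)
next
  case (Suc k)
  define T where "T w \<eta> S = constraint \<U> w \<eta> * resample q w (\<lambda>\<eta>'. G \<eta>' (insert w S)) \<eta>
      + (1 - constraint \<U> w \<eta>) * G \<eta> S" for w \<eta> S
  have T_outside: "T w \<eta> S = G \<eta> S" if "w \<in> \<Lambda> - B" for w \<eta> S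
    using Suc.prems(3,4)[OF that] by (simp add: T_def resample_ignored algebra_simps)
  have c_top: "ignores y (constraint \<U> w)" if "w \<in> B" for w
    using top that by (intro ignores_constraint) auto
  \<comment> \<open>Only a ring at \<open>y\<close> can bring \<open>y\<close> into the record, and
    what it contributes is the average of \<open>G\<close> over the spin at \<open>y\<close>, which
    is 0.\<close>
  have T0: "T w \<eta> S = 0" if "y \<notin> S" for w \<eta> S
  proof (cases "w = y")
    case False
    then have "(\<lambda>\<eta>'. G \<eta>' (insert w S)) = (\<lambda>_. 0)" using that Suc.prems(1) by auto
    then show ?thesis using that Suc.prems(1) by (simp add: T_def resample_def)
  qed (use that Suc.prems(1,2) in \<open>simp add: T_def\<close>)
  \<comment> \<open>For \<open>w\<close> in \<open>B\<close> the constraint does not read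
    \<open>y\<close>, so averaging over the spin at \<open>y\<close> passes through the ring at
    \<open>w\<close>.\<close>
  have Tr: "resample q y (\<lambda>\<eta>. T w \<eta> S) \<eta> = 0" if "w \<in> \<Lambda>" for w \<eta> S
  proof (cases "w \<in> B")
    case False
    then show ?thesis using that Suc.prems(2) by (simp add: T_outside)
  next
    case True
    have "resample q y (resample q w (\<lambda>\<eta>'. G \<eta>' (insert w S))) = resample q w (\<lambda>_. 0)"
      unfolding resample_commute[of q y w] by (intro arg_cong[where f = "resample q w"] ext Suc.prems(2))
    then have *: "resample q y (resample q w (\<lambda>\<eta>'. G \<eta>' (insert w S))) \<eta> = 0"
      by (simp add: resample_def)
    have c': "ignores y (\<lambda>\<eta>. 1 - constraint \<U> w \<eta>)"
      using c_top[OF True] by (simp add: ignores_def)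
    show ?thesis
      unfolding T_def resample_add resample_mult_ignored[OF c_top[OF True]] resample_mult_ignored[OF c']
      by (simp add: * Suc.prems(2))
  qed
  have Ti: "ignores z (\<lambda>\<eta>. T w \<eta> S)" if "w \<in> \<Lambda>" "z \<in> \<Lambda> - B" for w z S
  proof (cases "w \<in> B")
    case False
    then show ?thesis using that Suc.prems(3) by (simp add: T_outside)
  next
    case True
    have "ignores z (resample q w (\<lambda>\<eta>'. G \<eta>' (insert w S)))"
      by (intro ignores_resample Suc.prems(3) that)
    then show ?thesis
      using lower_ignores[OF B True that(2)] Suc.prems(3)[OF that(2)]
      by (simp add: T_def ignores_def)
  qed
  have Ts: "T w \<eta> (insert z S) = T w \<eta> S" if "z \<in> \<Lambda> - B" for w z \<eta> S
    using Suc.prems(4)[OF that] by (simp add: T_def insert_commute[of w z])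
  have rec: "record_op \<U> q n G = (\<lambda>\<eta> S. \<Sum>w\<in>\<Lambda>. T w \<eta> S)"
    by (simp add: fun_eq_iff record_op_def T_def)
  have "ev k (\<lambda>\<eta> S. \<Sum>w\<in>\<Lambda>. T w \<eta> S) = 0"
  proof (rule Suc.IH)
    show "ignores z (\<lambda>\<eta>. \<Sum>w\<in>\<Lambda>. T w \<eta> S)" if "z \<in> \<Lambda> - B" for z S
      using Ti[OF _ that] by (auto simp: ignores_def intro!: sum.cong)
  qed (simp_all add: T0 Tr Ts resample_sum)
  then show ?case by (simp add: ev_Suc rec)
qed

text \<open>On the event that \<open>y\<close> is in the record, \<open>f\<close> may be replaced by
  its average over the spin at \<open>y\<close>, since the difference is centred. This is an
  equality; the inequality comes from then dropping the event. The factor \<open>\<phi>\<close> may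
  still require other sites of \<open>B\<close> to be updated or not updated.\<close>

lemma ev_updated_le:
  assumes B: "lower_set \<U> n B" and y: "y \<in> B" and top: "\<And>w u. w \<in> B \<Longrightarrow> u \<in> \<Union>\<U> \<Longrightarrow> y \<noteq> w + u"
    and f: "\<And>z. z \<in> \<Lambda> - B \<Longrightarrow> ignores z f" "\<And>\<eta>. 0 \<le> f \<eta>"
    and \<phi>: "\<And>z S. z \<in> \<Lambda> - B \<Longrightarrow> \<phi> (insert z S) = \<phi> S" "\<And>S. 0 \<le> \<phi> S"
  shows "ev k (\<lambda>\<eta> S. f \<eta> * (\<phi> S * of_bool (y \<in> S))) \<le> ev k (\<lambda>\<eta> S. resample q y f \<eta> * \<phi> S)"
proof -
  let ?G = "\<lambda>\<eta> S. (\<phi> S * of_bool (y \<in> S)) * (f \<eta> - resample q y f \<eta>)"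
  have "ev k ?G = 0"
  proof (rule ev_updated_centred[OF B y top])
    show "resample q y (\<lambda>\<eta>. ?G \<eta> S) \<eta> = 0" for \<eta> S
      unfolding resample_mult_ignored[OF ignores_const] resample_diff
      by (simp add: resample_ignored[OF ignores_resample_same])
    show "ignores z (\<lambda>\<eta>. ?G \<eta> S)" if "z \<in> \<Lambda> - B" for z S
      using f(1)[OF that] ignores_resample[OF f(1)[OF that], of q y] by (simp add: ignores_def)
    show "?G \<eta> (insert z S) = ?G \<eta> S" if "z \<in> \<Lambda> - B" for z \<eta> S
      using y that \<phi>(1)[OF that] by auto
    show "?G \<eta> S = 0" if "y \<notin> S" for \<eta> S
      using that by simp
  qed
  moreover have "(\<lambda>\<eta> S. f \<eta> * (\<phi> S * of_bool (y \<in> S)))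
      = (\<lambda>\<eta> S. ?G \<eta> S + resample q y f \<eta> * (\<phi> S * of_bool (y \<in> S)))"
    by (simp add: fun_eq_iff algebra_simps)
  ultimately have "ev k (\<lambda>\<eta> S. f \<eta> * (\<phi> S * of_bool (y \<in> S)))
      = ev k (\<lambda>\<eta> S. resample q y f \<eta> * (\<phi> S * of_bool (y \<in> S)))"
    by (simp only: ev_add)
  also have "\<dots> \<le> ev k (\<lambda>\<eta> S. resample q y f \<eta> * \<phi> S)"
    using \<phi>(2) resample_nonneg[OF q', of f] f(2) by (intro ev_mono) (auto intro!: mult_left_mono)
  finally show ?thesis .
qed

lemma finite_top:
  assumes "finite D" "D \<noteq> {}"
  obtains y where "y \<in> D" "\<And>w u. w \<in> D \<Longrightarrow> u \<in> \<Union>\<U> \<Longrightarrow> y \<noteq> w + u"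
proof -
  have "Max (height ` D) \<in> height ` D"
    using assms by (intro Max_in) auto
  then obtain y where "y \<in> D" "height y = Max (height ` D)" by force
  then have y: "y \<in> D" "\<And>w. w \<in> D \<Longrightarrow> height w \<le> height y"
    using assms(1) by auto
  show thesis
  proof (rule that[OF y(1)])
    show "y \<noteq> w + u" if "w \<in> D" "u \<in> \<Union>\<U>" for w u
      using y(2)[OF that(1)] height[OF that(2), of w] by auto
  qed
qed

lemma lower_set_remove:
  assumes "lower_set \<U> n B" "\<And>w u. w \<in> B \<Longrightarrow> u \<in> \<Union>\<U> \<Longrightarrow> y \<noteq> w + u"
  shows "lower_set \<U> n (B - {y})"
  using assms unfolding lower_set_def by blast

text \<open>The highest site of \<open>B\<close> is averaged out and removed, which leaves the
  equilibrium mean unchanged. When no site is left, \<open>f\<close> is constant on configurations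
  and only the total mass \<open>vol ^ k\<close> remains.\<close>

lemma ev_all_updated_le_mean:
  assumes "lower_set \<U> n B" and "\<And>z. z \<in> \<Lambda> - B \<Longrightarrow> ignores z f" and "\<And>\<eta>. 0 \<le> f \<eta>"
  shows "ev k (\<lambda>\<eta> S. f \<eta> * of_bool (B \<subseteq> S)) \<le> vol ^ k * mean q n f"
  using assms
proof (induction "card B" arbitrary: B f)
  case 0
  with finite_lower_set[OF 0(2)] have B: "B = {}" by simp
  then have ign: "ignores z f" if "z \<in> \<Lambda>" for z using that 0 by simp
  have const: "f \<eta> = f start" if "\<eta> \<in> configs n" for \<eta>
    using ignores_all_sites_const[of n f, OF ign] that start by metis
  then have m: "mean q n f = f start" by (rule mean_const_on_configs)
  have "ev k (\<lambda>\<eta> S. f \<eta>) = vol ^ k * f start" for k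
  proof (induction k)
    case (Suc k)
    have "record_op \<U> q n (\<lambda>\<eta> S. f \<eta>) = (\<lambda>\<eta> S. \<Sum>y\<in>\<Lambda>. f \<eta>)"
      using ign by (auto simp: fun_eq_iff record_op_def resample_ignored algebra_simps intro!: sum.cong)
    moreover have "ev k (\<lambda>\<eta> S. \<Sum>y\<in>\<Lambda>. f \<eta>) = (\<Sum>y\<in>\<Lambda>. ev k (\<lambda>\<eta> S. f \<eta>))"
      by (rule ev_sum) (rule finite_site_box)
    ultimately show ?case by (simp only: ev_Suc Suc.IH) (simp add: vol)
  qed (simp add: ev_0)
  then show ?case by (simp add: B m)
next
  case (Suc m)
  have fin: "finite B" "B \<noteq> {}" using Suc.hyps(2) finite_lower_set[OF Suc.prems(1)] by auto
  then obtain y where y: "y \<in> B" and top: "\<And>w u. w \<in> B \<Longrightarrow> u \<in> \<Union>\<U> \<Longrightarrow> y \<noteq> w + u"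
    using finite_top by blast
  have yL: "y \<in> \<Lambda>" using y Suc.prems(1) by (auto simp: lower_set_def)
  have eq: "of_bool (B \<subseteq> S) = (of_bool (B - {y} \<subseteq> S) * of_bool (y \<in> S) :: real)" for S
    using y by auto
  have "ev k (\<lambda>\<eta> S. f \<eta> * of_bool (B \<subseteq> S)) \<le> ev k (\<lambda>\<eta> S. resample q y f \<eta> * of_bool (B - {y} \<subseteq> S))"
    unfolding eq by (rule ev_updated_le[OF Suc.prems(1) y top Suc.prems(2,3)]) auto
  also have "\<dots> \<le> vol ^ k * mean q n (resample q y f)"
  proof (rule Suc.hyps(1))
    show "m = card (B - {y})" using Suc.hyps(2) y by simp
    show "lower_set \<U> n (B - {y})" by (rule lower_set_remove[OF Suc.prems(1) top])
    show "ignores z (resample q y f)" if "z \<in> \<Lambda> - (B - {y})" for z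
      using that Suc.prems(2)[of z] by (cases "z = y") (auto intro: ignores_resample_same ignores_resample)
  qed (rule resample_nonneg[OF q' Suc.prems(3)])
  finally show ?case using mean_resample[OF q' yL] by simp
qed

text \<open>The sites of \<open>B\<close> outside the closed past cone of \<open>z\<close> have all
  been updated, so they are averaged out from the top, which does not increase the L2 norm. What
  remains is the event attached to the past cone of \<open>z\<close>; its bound is the assumption
  \<open>IH\<close>, to be supplied by an induction on \<open>k\<close>.\<close>

lemma ev_project_to_past_cone:
  assumes "lower_set \<U> n B" and z: "z \<in> \<Lambda>" and "insert z (past_cone \<U> n z) \<subseteq> B"
    and "\<And>y. y \<in> \<Lambda> - (B - {z}) \<Longrightarrow> ignores y g" and "\<And>\<eta>. 0 \<le> g \<eta>"
    and IH: "\<And>f. (\<And>y. y \<in> \<Lambda> - past_cone \<U> n z \<Longrightarrow> ignores y f) \<Longrightarrow> (\<And>\<eta>. 0 \<le> f \<eta>) \<Longrightarrow>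
        ev k (\<lambda>\<eta> S. f \<eta> * of_bool (past_cone \<U> n z \<subseteq> S \<and> z \<notin> S)) \<le> b * nrm q n f"
    and b: "0 \<le> b"
  shows "ev k (\<lambda>\<eta> S. g \<eta> * of_bool (B - {z} \<subseteq> S \<and> z \<notin> S)) \<le> b * nrm q n g"
  using assms(1,3-5)
proof (induction "card B" arbitrary: B g rule: less_induct)
  case less
  define D where "D = B - insert z (past_cone \<U> n z)"
  have fB: "finite B" by (rule finite_lower_set[OF less.prems(1)])
  have zc: "z \<notin> past_cone \<U> n z" using height_past_cone[of z z] by auto
  show ?case
  proof (cases "D = {}")
    case True
    then have "B - {z} = past_cone \<U> n z" using less.prems(2) zc by (auto simp: D_def)
    then show ?thesis using IH[of g] less.prems(3,4) by simp
  next
    case False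
    then obtain y where yD: "y \<in> D" and topD: "\<And>w u. w \<in> D \<Longrightarrow> u \<in> \<Union>\<U> \<Longrightarrow> y \<noteq> w + u"
      using finite_top[of D] fB by (auto simp: D_def)
    have y: "y \<in> B" "y \<noteq> z" "y \<in> \<Lambda>" using yD less.prems(1) by (auto simp: D_def lower_set_def)
    \<comment> \<open>The closed past cone of \<open>z\<close> reads no box site outside itself, so
      a site at the top of \<open>D\<close> is also at the top of \<open>B\<close>.\<close>
    have top: "y \<noteq> w + u" if "w \<in> B" "u \<in> \<Union>\<U>" for w u
    proof (cases "w \<in> D")
      case False
      then have "w \<in> insert z (past_cone \<U> n z)" using that by (auto simp: D_def)
      then show ?thesis
        using lower_set_insert_past_cone[OF z, of \<U>] that(2) y(3) yD unfolding lower_set_def D_def by blast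
    qed (use topD that in auto)
    have eq: "of_bool (B - {z} \<subseteq> S \<and> z \<notin> S)
        = (of_bool (B - {y} - {z} \<subseteq> S \<and> z \<notin> S) * of_bool (y \<in> S) :: real)" for S
      using y by auto
    have zB: "z \<in> B" using less.prems(2) by auto
    have "ev k (\<lambda>\<eta> S. g \<eta> * of_bool (B - {z} \<subseteq> S \<and> z \<notin> S))
        \<le> ev k (\<lambda>\<eta> S. resample q y g \<eta> * of_bool (B - {y} - {z} \<subseteq> S \<and> z \<notin> S))"
      unfolding eq
    proof (rule ev_updated_le[OF less.prems(1) y(1) top])
      show "of_bool (B - {y} - {z} \<subseteq> insert z' S \<and> z \<notin> insert z' S)
          = (of_bool (B - {y} - {z} \<subseteq> S \<and> z \<notin> S) :: real)" if "z' \<in> \<Lambda> - B" for z' S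
        using that zB by auto
    qed (use less.prems(3,4) in auto)
    also have "\<dots> \<le> b * nrm q n (resample q y g)"
    proof (rule less.hyps)
      show "card (B - {y}) < card B" using fB y(1) by (rule card_Diff1_less)
      show "lower_set \<U> n (B - {y})" by (rule lower_set_remove[OF less.prems(1) top])
      show "insert z (past_cone \<U> n z) \<subseteq> B - {y}" using less.prems(2) yD by (auto simp: D_def)
      show "ignores w (resample q y g)" if "w \<in> \<Lambda> - (B - {y} - {z})" for w
        using that less.prems(3)[of w] by (cases "w = y") (auto intro: ignores_resample_same ignores_resample)
    qed (rule resample_nonneg[OF q' less.prems(4)])
    also have "\<dots> \<le> b * nrm q n g"
      by (intro mult_left_mono nrm_resample_le q' y b)
    finally show ?thesis .
  qed
qed

end

lemma nrm_mono:
  assumes "\<And>\<eta>. \<bar>f \<eta>\<bar> \<le> \<bar>g \<eta>\<bar>"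
  shows "nrm q n f \<le> nrm q n g"
  using assms unfolding nrm_def by (intro real_sqrt_le_mono mean_mono) (simp add: abs_le_square_iff)

section \<open>Decay while a site has not been updated\<close>

context oriented_kcm
begin

text \<open>The alternative required for the contraction holds because \<open>f\<close> lives on the
  past cone of \<open>x\<close>: sites inside it do not read \<open>x\<close>, and sites outside it
  are ignored by \<open>f\<close>.\<close>

lemma nrm_killed_op_le:
  assumes gap: "poincare \<U> q n \<gamma>" "0 < \<gamma>" "\<gamma> \<le> 1" and x: "x \<in> \<Lambda>"
    and f: "\<And>y. y \<in> \<Lambda> - past_cone \<U> n x \<Longrightarrow> ignores y f"
  shows "nrm q n (killed_op \<U> q n x f) \<le> (vol - \<gamma> / 2) * nrm q n f"
proof -
  have vol1: "1 \<le> vol"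
    using x finite_site_box[of n] by (auto simp: vol Suc_le_eq card_gt_0_iff)
  have xc: "x \<notin> past_cone \<U> n x" using height_past_cone[of x x] by auto
  have "mean q n (\<lambda>\<eta>. (killed_op \<U> q n x f \<eta>)\<^sup>2) \<le> vol * (vol - \<gamma>) * mean q n (\<lambda>\<eta>. (f \<eta>)\<^sup>2)"
    unfolding vol
  proof (rule mean_square_killed_op_le[OF q x gap(1) self_ignores])
    show "ignores x f" using x xc f by blast
    show "ignores x (constraint \<U> y) \<or> ignores y f" if "y \<in> \<Lambda>" "y \<noteq> x" for y
      using lower_ignores[OF lower_set_past_cone, of y x x] xc x that f[of y] by blast
  qed
  \<comment> \<open>The square exceeds \<open>vol * (vol - \<gamma>)\<close> by a quarter of the
    square of \<open>\<gamma>\<close>.\<close>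
  also have "\<dots> \<le> (vol - \<gamma> / 2)\<^sup>2 * mean q n (\<lambda>\<eta>. (f \<eta>)\<^sup>2)"
    by (intro mult_right_mono) (auto simp: power2_eq_square field_simps)
  finally have "nrm q n (killed_op \<U> q n x f) \<le> sqrt ((vol - \<gamma> / 2)\<^sup>2 * mean q n (\<lambda>\<eta>. (f \<eta>)\<^sup>2))"
    unfolding nrm_def by (rule real_sqrt_le_mono)
  then show ?thesis
    using vol1 gap by (simp add: real_sqrt_mult nrm_def)
qed

text \<open>
  The bound is on the density of the spins in the past cone of \<open>x\<close>, on the event that \<open>x\<close> is the
  first site of its closed past cone not to be updated. Mass enters this event when the last site
  \<open>z\<close> of the past cone is updated, and it is then controlled by the same quantity for \<open>z\<close>.
\<close>

lemma ev_not_updated_le: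
  assumes gap: "poincare \<U> q n \<gamma>" "0 < \<gamma>" "\<gamma> \<le> 1"
    and W: "\<And>x. x \<in> \<Lambda> \<Longrightarrow> 1 \<le> W x"
      "\<And>x. x \<in> \<Lambda> \<Longrightarrow> (\<Sum>z\<in>past_cone \<U> n x. W z) \<le> \<gamma> / 4 * W x"
    and "x \<in> \<Lambda>" and "\<And>y. y \<in> \<Lambda> - past_cone \<U> n x \<Longrightarrow> ignores y f" and "\<And>\<eta>. 0 \<le> f \<eta>"
  shows "ev k (\<lambda>\<eta> S. f \<eta> * of_bool (past_cone \<U> n x \<subseteq> S \<and> x \<notin> S))
      \<le> W x * (vol - \<gamma> / 4) ^ k * nrm q n f"
  using assms(6-8)
proof (induction k arbitrary: x f)
  case 0
  \<comment> \<open>The record is empty, so the event can hold only for an empty cone, where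
    \<open>f\<close> is constant on configurations and its norm is its value. No norm of an initial
    density enters.\<close>
  show ?case
  proof (cases "past_cone \<U> n x = {}")
    case True
    then have ign: "ignores z f" if "z \<in> \<Lambda>" for z using that 0 by simp
    have "f \<eta> = f start" if "\<eta> \<in> configs n" for \<eta>
      using ignores_all_sites_const[of n f, OF ign] that start by metis
    then have "mean q n (\<lambda>\<eta>. (f \<eta>)\<^sup>2) = (f start)\<^sup>2" by (intro mean_const_on_configs) simp
    then have "nrm q n f = f start" using 0(3)[of start] by (simp add: nrm_def)
    then show ?thesis using W(1)[OF 0(1)] 0(3)[of start] mult_right_mono[of 1 "W x" "f start"]
      by (simp add: ev_0 True)
  next
    case False
    then show ?thesis using W(1)[OF 0(1)] nrm_nonneg[of q n f] by (simp add: ev_0)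
  qed
next
  case (Suc k)
  note x = Suc.prems(1)
  define C where "C = past_cone \<U> n x"
  define r where "r = vol - \<gamma> / 4"
  have CL: "C \<subseteq> \<Lambda>" by (auto simp: C_def past_cone_def)
  have finC: "finite C" using CL finite_site_box finite_subset by blast
  have xC: "x \<notin> C" using height_past_cone[of x x] by (auto simp: C_def)
  have vol1: "1 \<le> vol"
    using x finite_site_box[of n] by (auto simp: vol Suc_le_eq card_gt_0_iff)
  then have r0: "0 \<le> r" using gap by (simp add: r_def)
  let ?I = "\<lambda>S. of_bool (C \<subseteq> S \<and> x \<notin> S) :: real"
  let ?J = "\<lambda>z S. of_bool (C - {z} \<subseteq> S \<and> z \<notin> S) :: real"
  let ?g = "\<lambda>z \<eta>. constraint \<U> z \<eta> * resample q z f \<eta>"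
  have r_nonneg: "0 \<le> resample q z f \<eta>" for z \<eta>
    by (rule resample_nonneg[OF q' Suc.prems(3)])
  have g_nonneg: "0 \<le> ?g z \<eta>" for z \<eta>
    by (intro mult_nonneg_nonneg constraint_nonneg r_nonneg)
  have k_nonneg: "0 \<le> killed_op \<U> q n x f \<eta>" for \<eta>
    unfolding killed_op_def site_op_def
    by (intro add_nonneg_nonneg sum_nonneg mult_nonneg_nonneg Suc.prems(3) r_nonneg)
      (simp_all add: constraint_nonneg constraint_le_one)
  \<comment> \<open>A legal ring at \<open>x\<close> leaves the event, and a ring outside the closed
    cone does not affect it. A legal ring at \<open>y\<close> in the cone leads into the event if it
    already held or if \<open>y\<close> was the only missing site of the cone.\<close>
  have rec: "record_op \<U> q n (\<lambda>\<eta> S. f \<eta> * ?I S) \<eta> S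
      \<le> killed_op \<U> q n x f \<eta> * ?I S + (\<Sum>z\<in>C. ?g z \<eta> * ?J z S)" for \<eta> S
  proof -
    let ?T = "\<lambda>y. constraint \<U> y \<eta> * resample q y (\<lambda>\<eta>'. f \<eta>' * ?I (insert y S)) \<eta>
      + (1 - constraint \<U> y \<eta>) * (f \<eta> * ?I S)"
    have pull: "resample q y (\<lambda>\<eta>'. f \<eta>' * c) \<eta> = resample q y f \<eta> * c" for y c
      by (simp add: resample_def algebra_simps)
    have Tx: "?T x = (1 - constraint \<U> x \<eta>) * f \<eta> * ?I S"
      by (simp add: resample_ignored[OF ignores_const])
    have Ty: "?T y \<le> site_op \<U> q y f \<eta> * ?I S + (if y \<in> C then ?g y \<eta> * ?J y S else 0)"
      if y: "y \<in> \<Lambda> - {x}" for y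
    proof (cases "y \<in> C")
      case True
      have "?I (insert y S) \<le> ?I S + ?J y S" using True y by auto
      then have "?g y \<eta> * ?I (insert y S) \<le> ?g y \<eta> * (?I S + ?J y S)"
        by (rule mult_left_mono) (rule g_nonneg)
      then show ?thesis using True by (simp add: pull site_op_def algebra_simps)
    next
      case False
      then have "resample q y f = f" using y Suc.prems(2)[of y] by (simp add: C_def resample_ignored)
      moreover have "?I (insert y S) = ?I S" using False y by auto
      ultimately show ?thesis using False by (simp add: pull site_op_def algebra_simps)
    qed
    have "record_op \<U> q n (\<lambda>\<eta> S. f \<eta> * ?I S) \<eta> S = ?T x + (\<Sum>y\<in>\<Lambda> - {x}. ?T y)"
      unfolding record_op_def by (rule sum.remove[OF finite_site_box x])
    also have "\<dots> \<le> (1 - constraint \<U> x \<eta>) * f \<eta> * ?I S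
        + (\<Sum>y\<in>\<Lambda> - {x}. site_op \<U> q y f \<eta> * ?I S + (if y \<in> C then ?g y \<eta> * ?J y S else 0))"
      unfolding Tx by (intro add_left_mono sum_mono Ty)
    also have "\<dots> = killed_op \<U> q n x f \<eta> * ?I S + (\<Sum>y\<in>(\<Lambda> - {x}) \<inter> C. ?g y \<eta> * ?J y S)"
      unfolding sum.inter_restrict[OF finite_Diff[OF finite_site_box]]
      by (simp add: killed_op_def sum.distrib sum_distrib_right distrib_right)
    also have "(\<Lambda> - {x}) \<inter> C = C" using CL xC by auto
    finally show ?thesis .
  qed
  \<comment> \<open>The killed dynamics again yields a function of the cone, so the induction
    hypothesis applies to it with the contracted norm.\<close>
  have main: "ev k (\<lambda>\<eta> S. killed_op \<U> q n x f \<eta> * ?I S) \<le> W x * r ^ k * ((vol - \<gamma> / 2) * nrm q n f)"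
  proof -
    have "ev k (\<lambda>\<eta> S. killed_op \<U> q n x f \<eta> * ?I S) \<le> W x * r ^ k * nrm q n (killed_op \<U> q n x f)"
      unfolding C_def r_def
    proof (rule Suc.IH[OF x _ k_nonneg])
      fix y assume y: "y \<in> \<Lambda> - past_cone \<U> n x"
      have fy: "ignores y f" by (rule Suc.prems(2)[OF y])
      have kt: "ignores y (site_op \<U> q z f)" if z: "z \<in> \<Lambda> - {x}" for z
      proof (cases "z \<in> past_cone \<U> n x")
        case True
        then have "ignores y (constraint \<U> z)" by (rule lower_ignores[OF lower_set_past_cone _ y])
        then show ?thesis
          using fy ignores_resample[OF fy, of q z] by (simp add: site_op_def ignores_def)
      next
        case False
        then show ?thesis using z fy Suc.prems(2)[of z] by (simp add: site_op_ignored)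
      qed
      have cx: "ignores y (constraint \<U> x)"
        using lower_ignores[OF lower_set_insert_past_cone[OF x], of x y] self_ignores[of x] y
        by (cases "y = x") auto
      have "(\<Sum>z\<in>\<Lambda> - {x}. site_op \<U> q z f (\<eta>(y := b))) = (\<Sum>z\<in>\<Lambda> - {x}. site_op \<U> q z f \<eta>)" for \<eta> b
        by (intro sum.cong refl ignores_upd kt)
      then show "ignores y (killed_op \<U> q n x f)"
        using fy cx by (simp add: ignores_def killed_op_def)
    qed
    also have "\<dots> \<le> W x * r ^ k * ((vol - \<gamma> / 2) * nrm q n f)"
      using W(1)[OF x] r0 by (intro mult_left_mono nrm_killed_op_le[OF gap x Suc.prems(2)]) auto
    finally show ?thesis .
  qed
  \<comment> \<open>Before the ring at \<open>z\<close> the missing sites include \<open>z\<close>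
    and the rest of the cone is updated. The function \<open>?g z\<close> no longer depends on the
    spin at \<open>z\<close>, so it can be projected to the past cone of \<open>z\<close>.\<close>
  have side: "ev k (\<lambda>\<eta> S. ?g z \<eta> * ?J z S) \<le> W z * r ^ k * nrm q n f" if z: "z \<in> C" for z
  proof -
    have zL: "z \<in> \<Lambda>" using z CL by blast
    have "ev k (\<lambda>\<eta> S. ?g z \<eta> * ?J z S) \<le> W z * r ^ k * nrm q n (?g z)"
    proof (rule ev_project_to_past_cone[OF _ zL])
      show "lower_set \<U> n C" unfolding C_def by (rule lower_set_past_cone)
      show "insert z (past_cone \<U> n z) \<subseteq> C" using z past_cone_trans[of z \<U> n x] by (auto simp: C_def)
      show "ignores y (?g z)" if y: "y \<in> \<Lambda> - (C - {z})" for y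
      proof (cases "y = z")
        case True
        then show ?thesis using self_ignores[of z] ignores_resample_same[of z q f] by (simp add: ignores_def)
      next
        case False
        then have y': "y \<in> \<Lambda> - past_cone \<U> n x" using y by (auto simp: C_def)
        show ?thesis
          using lower_ignores[OF lower_set_past_cone _ y'] z ignores_resample[OF Suc.prems(2)[OF y'], of q z]
          by (simp add: ignores_def C_def)
      qed
      show "0 \<le> ?g z \<eta>" for \<eta> by (rule g_nonneg)
      show "0 \<le> W z * r ^ k" using W(1)[OF zL] r0 by simp
      show "ev k (\<lambda>\<eta> S. f \<eta> * of_bool (past_cone \<U> n z \<subseteq> S \<and> z \<notin> S)) \<le> W z * r ^ k * nrm q n f"
        if "\<And>y. y \<in> \<Lambda> - past_cone \<U> n z \<Longrightarrow> ignores y f" "\<And>\<eta>. 0 \<le> f \<eta>" for f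
        unfolding r_def by (rule Suc.IH[OF zL that])
    qed
    also have "nrm q n (?g z) \<le> nrm q n (resample q z f)"
    proof (rule nrm_mono)
      show "\<bar>?g z \<eta>\<bar> \<le> \<bar>resample q z f \<eta>\<bar>" for \<eta>
        using constraint_nonneg[of \<U> z \<eta>] constraint_le_one[of \<U> z \<eta>]
        by (simp add: abs_mult mult_left_le_one_le)
    qed
    also have "nrm q n (resample q z f) \<le> nrm q n f" by (rule nrm_resample_le[OF q' zL])
    finally show ?thesis using W(1)[OF zL] r0 by (simp add: mult_left_mono)
  qed
  have "ev (Suc k) (\<lambda>\<eta> S. f \<eta> * ?I S)
      \<le> ev k (\<lambda>\<eta> S. killed_op \<U> q n x f \<eta> * ?I S + (\<Sum>z\<in>C. ?g z \<eta> * ?J z S))"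
    unfolding ev_Suc by (intro ev_mono rec)
  also have "\<dots> = ev k (\<lambda>\<eta> S. killed_op \<U> q n x f \<eta> * ?I S) + (\<Sum>z\<in>C. ev k (\<lambda>\<eta> S. ?g z \<eta> * ?J z S))"
    by (simp add: ev_add ev_sum[OF finC])
  also have "\<dots> \<le> W x * r ^ k * ((vol - \<gamma> / 2) * nrm q n f) + (\<Sum>z\<in>C. W z * r ^ k * nrm q n f)"
    by (intro add_mono main sum_mono side)
  also have "(\<Sum>z\<in>C. W z * r ^ k * nrm q n f) = (\<Sum>z\<in>C. W z) * (r ^ k * nrm q n f)"
    by (simp add: sum_distrib_right mult.assoc)
  \<comment> \<open>The inflow uses up half of the decay \<open>\<gamma> / 2\<close>, which leaves
    the rate \<open>\<gamma> / 4\<close>.\<close>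
  also have "\<dots> \<le> \<gamma> / 4 * W x * (r ^ k * nrm q n f)"
    using W(2)[OF x] r0 by (intro mult_right_mono) (auto simp: C_def nrm_nonneg)
  finally show ?case
    by (simp add: C_def r_def algebra_simps)
qed

text \<open>Either every site has been updated, and equilibrium dominates, or some site is missing
  whose whole past cone has been updated. The latter is bounded with the test function 1, of norm
  1.\<close>

lemma unif_op_indicator_le:
  assumes gap: "poincare \<U> q n \<gamma>" "0 < \<gamma>" "\<gamma> \<le> 1"
    and W: "\<And>x. x \<in> \<Lambda> \<Longrightarrow> 1 \<le> W x"
      "\<And>x. x \<in> \<Lambda> \<Longrightarrow> (\<Sum>z\<in>past_cone \<U> n x. W z) \<le> \<gamma> / 4 * W x"
  shows "(unif_op \<U> q n ^^ k) (indicator A) start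
      \<le> vol ^ k * measure_pmf.prob (equilibrium q n) A + (\<Sum>x\<in>\<Lambda>. W x) * (vol - \<gamma> / 4) ^ k"
proof -
  let ?J = "\<lambda>x S. of_bool (past_cone \<U> n x \<subseteq> S \<and> x \<notin> S) :: real"
  have le: "indicator A \<eta> \<le> indicator A \<eta> * of_bool (\<Lambda> \<subseteq> S) + (\<Sum>x\<in>\<Lambda>. 1 * ?J x S)" for \<eta> S
  proof (cases "\<Lambda> \<subseteq> S")
    case True
    then show ?thesis by (simp add: sum_nonneg)
  next
    case False
    \<comment> \<open>A missing site of minimal height: its past cone is strictly lower, hence
      contains no missing site.\<close>
    then obtain x where x: "x \<in> \<Lambda> - S" and least: "\<And>z. z \<in> \<Lambda> - S \<Longrightarrow> height x \<le> height z"
      using arg_min_if_finite[of "\<Lambda> - S" height] finite_site_box[of n]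
      by (metis Diff_eq_empty_iff finite_Diff linorder_not_le)
    have "past_cone \<U> n x \<subseteq> S"
      using least height_past_cone[of _ x] past_cone_subset[of \<U> n x] by force
    then have "1 = ?J x S" using x by simp
    also have "\<dots> \<le> (\<Sum>x\<in>\<Lambda>. ?J x S)"
      using x by (intro member_le_sum) (auto simp: finite_site_box)
    finally show ?thesis using False by (simp add: indicator_def)
  qed
  have J: "ev k (\<lambda>\<eta> S. 1 * ?J x S) \<le> W x * (vol - \<gamma> / 4) ^ k" if x: "x \<in> \<Lambda>" for x
    using ev_not_updated_le[OF gap W x, of "\<lambda>_. 1" k]
    by (simp add: ignores_const nrm_def)
  have "(unif_op \<U> q n ^^ k) (indicator A) start = ev k (\<lambda>\<eta> S. indicator A \<eta>)"
    by (rule ev_spins[symmetric])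
  also have "\<dots> \<le> ev k (\<lambda>\<eta> S. indicator A \<eta> * of_bool (\<Lambda> \<subseteq> S) + (\<Sum>x\<in>\<Lambda>. 1 * ?J x S))"
    by (rule ev_mono) (rule le)
  also have "\<dots> = ev k (\<lambda>\<eta> S. indicator A \<eta> * of_bool (\<Lambda> \<subseteq> S)) + (\<Sum>x\<in>\<Lambda>. ev k (\<lambda>\<eta> S. 1 * ?J x S))"
    unfolding ev_add ev_sum[OF finite_site_box] ..
  also have "\<dots> \<le> vol ^ k * mean q n (indicator A) + (\<Sum>x\<in>\<Lambda>. W x * (vol - \<gamma> / 4) ^ k)"
    by (intro add_mono sum_mono J ev_all_updated_le_mean) (auto simp: lower_set_def)
  finally show ?thesis by (simp add: sum_distrib_right)
qed

end

section \<open>Uniformization\<close>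

lemma unif_op_eq:
  fixes f :: "'d::finite config \<Rightarrow> real"
  shows "unif_op \<U> q n f \<eta> = generator \<U> q n f \<eta> + real (card (site_box n :: (int ^ 'd) set)) * f \<eta>"
  by (simp add: unif_op_def site_op_def generator_def algebra_simps sum.distrib sum_subtractf)

lemma generator_funpow_cmult:
  "(generator \<U> q n ^^ k) (\<lambda>\<eta>. a * f \<eta>) = (\<lambda>\<eta>. a * (generator \<U> q n ^^ k) f \<eta>)"
  by (induction k) (simp_all add: generator_cmult)

text \<open>Pascal's rule in the form needed to expand powers of an operator plus the scalar
  \<open>v\<close>.\<close>

lemma sum_binomial_Suc:
  fixes a :: "nat \<Rightarrow> 'a::comm_semiring_1"
  shows "(\<Sum>i\<le>Suc k. of_nat (Suc k choose i) * v ^ (Suc k - i) * a i)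
    = (\<Sum>i\<le>k. of_nat (k choose i) * v ^ (k - i) * (a (Suc i) + v * a i))"
proof -
  have "(\<Sum>i\<le>Suc k. of_nat (Suc k choose i) * v ^ (Suc k - i) * a i)
      = v ^ Suc k * a 0 + (\<Sum>i\<le>k. of_nat (k choose Suc i) * v ^ (k - i) * a (Suc i))
        + (\<Sum>i\<le>k. of_nat (k choose i) * v ^ (k - i) * a (Suc i))"
    by (simp only: sum.atMost_Suc_shift) (simp add: sum.distrib algebra_simps)
  also have "v ^ Suc k * a 0 + (\<Sum>i\<le>k. of_nat (k choose Suc i) * v ^ (k - i) * a (Suc i))
      = (\<Sum>i\<le>Suc k. of_nat (k choose i) * v ^ (Suc k - i) * a i)"
    by (simp only: sum.atMost_Suc_shift) simp
  also have "\<dots> = (\<Sum>i\<le>k. of_nat (k choose i) * v ^ (Suc k - i) * a i)"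
    by (simp add: binomial_eq_0)
  also have "\<dots> = (\<Sum>i\<le>k. of_nat (k choose i) * v ^ (k - i) * (v * a i))"
    by (intro sum.cong) (auto simp: Suc_diff_le algebra_simps)
  finally show ?thesis
    by (simp add: sum.distrib[symmetric] distrib_left add.commute)
qed

lemma unif_op_funpow:
  fixes f :: "'d::finite config \<Rightarrow> real"
  shows "(unif_op \<U> q n ^^ k) f \<eta> = (\<Sum>i\<le>k. of_nat (k choose i)
    * real (card (site_box n :: (int ^ 'd) set)) ^ (k - i) * (generator \<U> q n ^^ i) f \<eta>)"
proof (induction k arbitrary: f)
  case (Suc k)
  let ?v = "real (card (site_box n :: (int ^ 'd) set))"
  have "unif_op \<U> q n f = (\<lambda>\<eta>. generator \<U> q n f \<eta> + ?v * f \<eta>)"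
    by (rule ext) (rule unif_op_eq)
  then have "(generator \<U> q n ^^ i) (unif_op \<U> q n f) \<eta>
      = (generator \<U> q n ^^ Suc i) f \<eta> + ?v * (generator \<U> q n ^^ i) f \<eta>" for i
    by (simp only: generator_funpow_add generator_funpow_cmult funpow_Suc_right comp_def)
  then show ?case
    unfolding sum_binomial_Suc funpow_Suc_right comp_def by (simp only: Suc.IH)
qed simp

text \<open>The Cauchy product of the series of exp (t L) and exp (t v); since the scalar
  \<open>v\<close> commutes with the generator, the binomial expansion of powers of
  \<open>unif_op\<close> appears.\<close>

lemma semigroup_uniformization:
  fixes f :: "'d::finite config \<Rightarrow> real"
  assumes q: "0 \<le> q" "q \<le> 1" and \<eta>: "\<eta> \<in> configs n"
  defines "v \<equiv> real (card (site_box n :: (int ^ 'd) set))"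
  shows "(\<lambda>k. t ^ k / fact k * (unif_op \<U> q n ^^ k) f \<eta>) sums (semigroup \<U> q n t f \<eta> * exp (t * v))"
proof -
  let ?a = "\<lambda>k. t ^ k / fact k * (generator \<U> q n ^^ k) f \<eta>" and ?b = "\<lambda>k. (t * v) ^ k / fact k"
  have "(\<lambda>k. \<Sum>i\<le>k. ?a i * ?b (k - i)) sums ((\<Sum>k. ?a k) * (\<Sum>k. ?b k))"
  proof (rule Cauchy_product_sums)
    show "summable (\<lambda>k. norm (?a k))"
      using semigroup_abs_summable[OF q \<eta>] by simp
    show "summable (\<lambda>k. norm (?b k))"
      using summable_norm_exp[of "t * v"] by (simp add: field_simps)
  qed
  moreover have "(\<Sum>i\<le>k. ?a i * ?b (k - i)) = t ^ k / fact k * (unif_op \<U> q n ^^ k) f \<eta>" for k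
    unfolding unif_op_funpow sum_distrib_left v_def[symmetric]
  proof (intro sum.cong refl)
    fix i assume "i \<in> {..k}"
    then have i: "i \<le> k" by simp
    then have "t ^ k = t ^ i * t ^ (k - i)" by (simp add: power_add[symmetric])
    then show "?a i * ?b (k - i)
        = t ^ k / fact k * (of_nat (k choose i) * v ^ (k - i) * (generator \<U> q n ^^ i) f \<eta>)"
      using binomial_fact[OF i, where 'a = real] by (simp add: power_mult_distrib field_simps)
  qed
  moreover have "(\<Sum>k. ?b k) = exp (t * v)" by (simp add: exp_def field_simps)
  ultimately show ?thesis by (simp add: semigroup_def)
qed

text \<open>The number of rings up to time \<open>t\<close> is Poisson with mean
  \<open>t * v\<close>; averaging over it turns \<open>v ^ k\<close> into 1 and \<open>r ^ k\<close>
  into \<open>exp ((r - v) * t)\<close>.\<close>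

lemma semigroup_le_of_unif_op:
  fixes f :: "'d::finite config \<Rightarrow> real"
  assumes q: "0 \<le> q" "q \<le> 1" and \<eta>: "\<eta> \<in> configs n" and t: "0 \<le> t"
  defines "v \<equiv> real (card (site_box n :: (int ^ 'd) set))"
  assumes le: "\<And>k. (unif_op \<U> q n ^^ k) f \<eta> \<le> v ^ k * a + c * r ^ k"
  shows "semigroup \<U> q n t f \<eta> \<le> a + c * exp ((r - v) * t)"
proof -
  have ex: "(\<lambda>k. x ^ k / fact k) sums exp x" for x :: real
    using exp_converges[of x] by (simp add: field_simps)
  have "(\<lambda>k. a * ((t * v) ^ k / fact k) + c * ((t * r) ^ k / fact k)) sums (a * exp (t * v) + c * exp (t * r))"
    by (intro sums_add sums_mult ex)
  then have "semigroup \<U> q n t f \<eta> * exp (t * v) \<le> a * exp (t * v) + c * exp (t * r)"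
  proof (rule sums_le[rotated 2])
    show "(\<lambda>k. t ^ k / fact k * (unif_op \<U> q n ^^ k) f \<eta>) sums (semigroup \<U> q n t f \<eta> * exp (t * v))"
      unfolding v_def by (rule semigroup_uniformization[OF q \<eta>])
    fix k
    have "t ^ k / fact k * (unif_op \<U> q n ^^ k) f \<eta> \<le> t ^ k / fact k * (v ^ k * a + c * r ^ k)"
      using t by (intro mult_left_mono le) simp
    then show "t ^ k / fact k * (unif_op \<U> q n ^^ k) f \<eta> \<le> a * ((t * v) ^ k / fact k) + c * ((t * r) ^ k / fact k)"
      by (simp add: power_mult_distrib field_simps)
  qed
  also have "\<dots> = (a + c * exp ((r - v) * t)) * exp (t * v)"
    by (simp add: distrib_right mult.assoc exp_add[symmetric] algebra_simps)
  finally show ?thesis by simp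
qed

lemma unif_op_mono:
  assumes "0 \<le> q" "q \<le> 1" "\<And>\<eta>. f \<eta> \<le> g \<eta>"
  shows "unif_op \<U> q n f \<eta> \<le> unif_op \<U> q n g \<eta>"
  unfolding unif_op_def site_op_def
  by (intro sum_mono add_mono mult_left_mono resample_mono assms)
    (simp_all add: constraint_nonneg constraint_le_one)

lemma unif_op_cmult: "unif_op \<U> q n (\<lambda>\<eta>. a * f \<eta>) = (\<lambda>\<eta>. a * unif_op \<U> q n f \<eta>)"
  by (simp add: fun_eq_iff unif_op_def site_op_def resample_def sum_distrib_left algebra_simps)

lemma unif_op_funpow_le:
  assumes q: "0 \<le> q" "q \<le> 1" and r: "0 \<le> r"
    and f: "\<And>\<eta>. f \<eta> \<le> \<phi> \<eta>" and \<phi>: "\<And>\<eta>. unif_op \<U> q n \<phi> \<eta> \<le> r * \<phi> \<eta>"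
  shows "(unif_op \<U> q n ^^ k) f \<eta> \<le> r ^ k * \<phi> \<eta>"
proof (induction k arbitrary: \<eta>)
  case (Suc k)
  have "(unif_op \<U> q n ^^ Suc k) f \<eta> \<le> unif_op \<U> q n (\<lambda>\<eta>. r ^ k * \<phi> \<eta>) \<eta>"
    by (simp add: unif_op_mono[OF q Suc.IH])
  also have "\<dots> \<le> r ^ k * (r * \<phi> \<eta>)"
    unfolding unif_op_cmult using r by (intro mult_left_mono \<phi>) simp
  finally show ?case by (simp add: ac_simps)
qed (simp add: f)

section \<open>Total variation bounds\<close>

text \<open>A one-sided bound for all events suffices, because the complement supplies the other
  side.\<close>

lemma worst_tv_le:
  fixes \<U> :: "(int ^ 'd::finite) set set"
  assumes q: "0 \<le> q" "q \<le> 1"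
    and le: "\<And>\<eta> A. \<eta> \<in> configs n \<Longrightarrow>
      law \<U> q n \<eta> t A \<le> measure_pmf.prob (equilibrium q n) A + b"
  shows "worst_tv \<U> q n t \<le> b"
proof -
  have ne: "(\<lambda>_. False) \<in> configs n" by (simp add: configs_def PiE_dflt_def)
  have "tv_to_equilibrium \<U> q n \<eta> t \<le> b" if \<eta>: "\<eta> \<in> configs n" for \<eta>
    unfolding tv_to_equilibrium_def
  proof (rule cSUP_least)
    fix A assume "A \<in> Pow (configs n :: 'd config set)"
    then have A: "A \<subseteq> configs n" by simp
    let ?P = "measure_pmf.prob (equilibrium q n :: 'd config pmf)"
    have "law \<U> q n \<eta> t (A \<union> (configs n - A)) = law \<U> q n \<eta> t A + law \<U> q n \<eta> t (configs n - A)"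
      by (intro law_Un q \<eta>) auto
    moreover have "A \<union> (configs n - A) = configs n" using A by auto
    ultimately have l: "law \<U> q n \<eta> t A + law \<U> q n \<eta> t (configs n - A) = 1"
      by (simp add: law_configs[OF \<eta>])
    have "?P (configs n) = 1"
      using set_equilibrium[of q n, where 'd = 'd]
      by (auto simp: measure_pmf.prob_eq_1 AE_measure_pmf_iff)
    moreover have "?P (configs n - A) = ?P (configs n) - ?P A"
      using A by (intro measure_pmf.finite_measure_Diff) auto
    ultimately have p: "?P A + ?P (configs n - A) = 1" by simp
    show "\<bar>law \<U> q n \<eta> t A - ?P A\<bar> \<le> b"
      using le[OF \<eta>, of A] le[OF \<eta>, of "configs n - A"] l p by linarith
  qed auto
  then show ?thesis unfolding worst_tv_def using ne by (intro cSUP_least) auto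
qed

lemma worst_tv_ge:
  assumes \<eta>: "\<eta> \<in> configs n" and A: "A \<subseteq> configs n"
  shows "\<bar>law \<U> q n \<eta> t A - measure_pmf.prob (equilibrium q n) A\<bar> \<le> worst_tv \<U> q n t"
proof -
  have "\<bar>law \<U> q n \<eta> t A - measure_pmf.prob (equilibrium q n) A\<bar> \<le> tv_to_equilibrium \<U> q n \<eta> t"
    unfolding tv_to_equilibrium_def using A
    by (intro cSUP_upper) (auto intro!: bdd_above_finite finite_imageI finite_configs)
  also have "\<dots> \<le> worst_tv \<U> q n t"
    unfolding worst_tv_def using \<eta>
    by (intro cSUP_upper) (auto intro!: bdd_above_finite finite_imageI finite_configs)
  finally show ?thesis .
qed

lemma (in oriented_kcm) law_le:
  assumes gap: "poincare \<U> q n \<gamma>" "0 < \<gamma>" "\<gamma> \<le> 1" and t: "0 \<le> t"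
    and W: "\<And>x. x \<in> \<Lambda> \<Longrightarrow> 1 \<le> W x"
      "\<And>x. x \<in> \<Lambda> \<Longrightarrow> (\<Sum>z\<in>past_cone \<U> n x. W z) \<le> \<gamma> / 4 * W x"
  shows "law \<U> q n start t A
    \<le> measure_pmf.prob (equilibrium q n) A + (\<Sum>x\<in>\<Lambda>. W x) * exp (- (\<gamma> / 4) * t)"
proof -
  have "semigroup \<U> q n t (indicator A) start \<le> measure_pmf.prob (equilibrium q n) A
      + (\<Sum>x\<in>\<Lambda>. W x) * exp ((vol - \<gamma> / 4 - vol) * t)"
    unfolding vol
    by (rule semigroup_le_of_unif_op[OF q' start t], fold vol, rule unif_op_indicator_le[OF gap W])
  then show ?thesis by (simp add: law_def)
qed

section \<open>Finite speed of propagation\<close>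

lemma constraint_le_sum:
  assumes "finite (\<Union>\<U>)" "\<And>U. U \<in> \<U> \<Longrightarrow> U \<noteq> {}"
  shows "constraint \<U> y \<eta> \<le> (\<Sum>u\<in>\<Union>\<U>. of_bool (\<not> \<eta> (y + u)))"
proof (cases "\<exists>U\<in>\<U>. \<forall>z\<in>(+) y ` U. \<not> \<eta> z")
  case True
  then obtain U u where "U \<in> \<U>" "u \<in> U" "\<not> \<eta> (y + u)" using assms(2) by blast
  then have "u \<in> \<Union>\<U>" "of_bool (\<not> \<eta> (y + u)) = (1::real)" by auto
  then have "1 \<le> (\<Sum>u\<in>\<Union>\<U>. of_bool (\<not> \<eta> (y + u)) :: real)"
    using member_le_sum[of u "\<Union>\<U>" "\<lambda>u. of_bool (\<not> \<eta> (y + u)) :: real"] assms(1) by simp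
  then show ?thesis using constraint_le_one[of \<U> y \<eta>] by linarith
next
  case False
  then have "constraint \<U> y \<eta> = 0" by (simp only: constraint_def of_bool_eq)
  then show ?thesis by (simp add: sum_nonneg)
qed

text \<open>
  An exponentially weighted count of zeros is, up to the contribution of the boundary, a
  subsolution: a site can only be updated next to a zero, or near the boundary.
\<close>

lemma unif_op_weighted_zeros_le:
  fixes \<U> :: "(int ^ 'd::finite) set set" and a :: "int ^ 'd \<Rightarrow> real"
  assumes q: "0 \<le> q" "q \<le> 1" and fin: "finite (\<Union>\<U>)" and ne: "\<And>U. U \<in> \<U> \<Longrightarrow> U \<noteq> {}"
    and a: "\<And>y. 0 \<le> a y" and \<rho>: "0 < \<rho>" "\<And>y u. u \<in> \<Union>\<U> \<Longrightarrow> a y \<le> \<rho> * a (y + u)"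
    and b: "\<And>u. u \<in> \<Union>\<U> \<Longrightarrow> (\<Sum>y\<in>{y \<in> site_box n. y + u \<notin> site_box n}. a y) \<le> b"
  defines "\<phi> \<equiv> \<lambda>\<eta>. (\<Sum>y\<in>site_box n. a y * of_bool (\<not> \<eta> y)) + b / \<rho>"
  defines "v \<equiv> real (card (site_box n :: (int ^ 'd) set))"
  shows "unif_op \<U> q n \<phi> \<eta> \<le> (v + real (card (\<Union>\<U>)) * \<rho>) * \<phi> \<eta>"
proof -
  let ?z = "\<lambda>y. of_bool (\<not> \<eta> y) :: real"
  have diff: "resample q y \<phi> \<eta> - \<phi> \<eta> \<le> a y" if y: "y \<in> site_box n" for y
  proof -
    have upd: "\<phi> (\<eta>(y := c)) = \<phi> \<eta> + a y * (of_bool (\<not> c) - ?z y)" for c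
    proof -
      have "(\<Sum>x\<in>site_box n - {y}. a x * of_bool (\<not> (\<eta>(y := c)) x)) = (\<Sum>x\<in>site_box n - {y}. a x * ?z x)"
        by (intro sum.cong) auto
      then show ?thesis
        unfolding \<phi>_def sum.remove[OF finite_site_box y] by (simp add: algebra_simps)
    qed
    have "resample q y \<phi> \<eta> - \<phi> \<eta> = a y * (q - ?z y)"
      unfolding resample_def upd by (simp add: algebra_simps)
    also have "\<dots> \<le> a y * 1" using q a by (intro mult_left_mono) auto
    finally show ?thesis by simp
  qed
  \<comment> \<open>Zeros inside the box are charged to their own weight by the shift, at the price
    \<open>\<rho>\<close>. Those outside contribute at most \<open>b\<close>, which is
    \<open>\<rho>\<close> times the constant term \<open>b / \<rho>\<close> of
    \<open>\<phi>\<close>; this is why that term is there.\<close>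
  have per_step: "(\<Sum>y\<in>site_box n. a y * ?z (y + u)) \<le> \<rho> * \<phi> \<eta>" if u: "u \<in> \<Union>\<U>" for u
  proof -
    let ?I = "{y \<in> site_box n. y + u \<in> site_box n}" and ?O = "{y \<in> site_box n. y + u \<notin> site_box n}"
    have "(\<Sum>y\<in>site_box n. a y * ?z (y + u)) = (\<Sum>y\<in>?I. a y * ?z (y + u)) + (\<Sum>y\<in>?O. a y * ?z (y + u))"
      using finite_site_box[of n] by (subst sum.union_disjoint[symmetric]) (auto intro: sum.cong)
    also have "(\<Sum>y\<in>?O. a y * ?z (y + u)) \<le> (\<Sum>y\<in>?O. a y)"
      using a by (intro sum_mono) auto
    also have "\<dots> \<le> b" by (rule b[OF u])
    also have "(\<Sum>y\<in>?I. a y * ?z (y + u)) \<le> (\<Sum>y\<in>?I. (\<rho> * a (y + u)) * ?z (y + u))"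
      using \<rho>(2)[OF u] by (intro sum_mono mult_right_mono) auto
    also have "\<dots> = (\<Sum>x\<in>(\<lambda>y. y + u) ` ?I. (\<rho> * a x) * ?z x)"
      by (subst sum.reindex) (auto simp: inj_on_def)
    also have "\<dots> \<le> (\<Sum>x\<in>site_box n. (\<rho> * a x) * ?z x)"
      using a \<rho>(1) by (intro sum_mono2 finite_site_box) auto
    finally show ?thesis using \<rho>(1) by (simp add: \<phi>_def sum_distrib_left mult.assoc distrib_left)
  qed
  have "generator \<U> q n \<phi> \<eta> \<le> (\<Sum>y\<in>site_box n. constraint \<U> y \<eta> * a y)"
    unfolding generator_def by (intro sum_mono mult_left_mono diff constraint_nonneg)
  also have "\<dots> \<le> (\<Sum>y\<in>site_box n. (\<Sum>u\<in>\<Union>\<U>. ?z (y + u)) * a y)"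
    by (intro sum_mono mult_right_mono constraint_le_sum fin ne a)
  also have "\<dots> = (\<Sum>u\<in>\<Union>\<U>. \<Sum>y\<in>site_box n. a y * ?z (y + u))"
    by (subst sum.swap) (simp add: sum_distrib_left mult.commute)
  also have "\<dots> \<le> (\<Sum>u\<in>\<Union>\<U>. \<rho> * \<phi> \<eta>)"
    by (intro sum_mono per_step)
  finally show ?thesis by (simp add: unif_op_eq v_def algebra_simps)
qed

text \<open>Markov's inequality for the weighted count of zeros: it is at least \<open>c\<close> on
  \<open>A\<close>, and from the all-ones start only its constant term \<open>b / \<rho>\<close> is
  present.\<close>

lemma law_some_zero_le:
  fixes \<U> :: "(int ^ 'd::finite) set set" and a :: "int ^ 'd \<Rightarrow> real"
  assumes q: "0 \<le> q" "q \<le> 1" and fin: "finite (\<Union>\<U>)" and ne: "\<And>U. U \<in> \<U> \<Longrightarrow> U \<noteq> {}"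
    and a: "\<And>y. 0 \<le> a y" and \<rho>: "0 < \<rho>" "\<And>y u. u \<in> \<Union>\<U> \<Longrightarrow> a y \<le> \<rho> * a (y + u)"
    and b: "\<And>u. u \<in> \<Union>\<U> \<Longrightarrow> (\<Sum>y\<in>{y \<in> site_box n. y + u \<notin> site_box n}. a y) \<le> b" "0 \<le> b"
    and B: "B \<subseteq> site_box n" "\<And>y. y \<in> B \<Longrightarrow> c \<le> a y" and c: "0 < c" and t: "0 \<le> t"
    and A: "A \<subseteq> {\<eta>. \<exists>y\<in>B. \<not> \<eta> y}"
  shows "law \<U> q n (\<lambda>y. y \<in> site_box n) t A \<le> b / (\<rho> * c) * exp (real (card (\<Union>\<U>)) * \<rho> * t)"
proof -
  define v where "v = real (card (site_box n :: (int ^ 'd) set))"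
  define \<phi> where "\<phi> \<eta> = (\<Sum>y\<in>site_box n. a y * of_bool (\<not> \<eta> y)) + b / \<rho>" for \<eta>
  define M where "M = real (card (\<Union>\<U>)) * \<rho>"
  let ?s = "\<lambda>y :: int ^ 'd. y \<in> site_box n"
  have s: "?s \<in> configs n" by (simp add: configs_def PiE_dflt_def)
  have \<phi>s: "\<phi> ?s = b / \<rho>" by (simp add: \<phi>_def)
  have ind: "indicator A \<eta> \<le> 1 / c * \<phi> \<eta>" for \<eta>
  proof (cases "\<eta> \<in> A")
    case True
    then obtain y where y: "y \<in> B" "\<not> \<eta> y" using A by auto
    have "c \<le> a y * of_bool (\<not> \<eta> y)" using B(2)[OF y(1)] y(2) by simp
    also have "\<dots> \<le> (\<Sum>y\<in>site_box n. a y * of_bool (\<not> \<eta> y))"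
      using y(1) B(1) a by (intro member_le_sum) (auto simp: finite_site_box)
    also have "\<dots> \<le> \<phi> \<eta>" using b(2) \<rho>(1) by (simp add: \<phi>_def)
    finally show ?thesis using True c by simp
  next
    case False
    then show ?thesis using a b(2) \<rho>(1) c by (simp add: \<phi>_def sum_nonneg)
  qed
  have sub: "unif_op \<U> q n \<phi> \<eta> \<le> (v + M) * \<phi> \<eta>" for \<eta>
    unfolding v_def M_def using unif_op_weighted_zeros_le[OF q fin ne a \<rho> b(1), of \<eta>]
    by (simp add: \<phi>_def[abs_def])
  have "unif_op \<U> q n (\<lambda>\<eta>. 1 / c * \<phi> \<eta>) \<eta> \<le> (v + M) * (1 / c * \<phi> \<eta>)" for \<eta>
    unfolding unif_op_cmult using sub[of \<eta>] c by (simp add: field_simps)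
  then have "(unif_op \<U> q n ^^ k) (indicator A) ?s \<le> (v + M) ^ k * (1 / c * \<phi> ?s)" for k
    by (intro unif_op_funpow_le q ind) (use \<rho>(1) in \<open>auto simp: v_def M_def\<close>)
  then have "semigroup \<U> q n t (indicator A) ?s \<le> 0 + b / (\<rho> * c) * exp ((v + M - v) * t)"
    unfolding v_def[symmetric] \<phi>s
    by (intro semigroup_le_of_unif_op[OF q s t, folded v_def]) (simp add: mult.commute)
  then show ?thesis by (simp add: law_def M_def)
qed

section \<open>The mixing time\<close>

lemma poincare_of_spectral_gap:
  fixes \<U> :: "(int ^ 'd::finite) set set"
  assumes \<gamma>: "0 < \<gamma>" "ereal \<gamma> \<le> spectral_gap \<U> q n"
  shows "poincare \<U> q n \<gamma>"
  unfolding poincare_def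
proof
  fix g :: "'d config \<Rightarrow> real"
  let ?V = "measure_pmf.variance (equilibrium q n) g" and ?D = "- mean q n (\<lambda>\<eta>. g \<eta> * generator \<U> q n g \<eta>)"
  show "\<gamma> * ?V \<le> ?D"
  proof (cases "g constant_on configs n")
    case True
    then obtain c where c: "\<And>\<eta>. \<eta> \<in> configs n \<Longrightarrow> g \<eta> = c" by (auto simp: constant_on_def)
    have "generator \<U> q n g \<eta> = 0" if "\<eta> \<in> configs n" for \<eta>
    proof -
      have "generator \<U> q n g \<eta> = generator \<U> q n (\<lambda>_. c) \<eta>"
        by (rule generator_cong[OF c that])
      then show ?thesis by (simp add: generator_def resample_def algebra_simps)
    qed
    then have "?D = 0" by (simp add: mean_const_on_configs[where c = 0])
    moreover have "mean q n g = c" by (rule mean_const_on_configs) (rule c)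
    then have "?V = 0" by (intro mean_const_on_configs) (simp add: c)
    ultimately show ?thesis by simp
  next
    case False
    then have "spectral_gap \<U> q n \<le> ereal (?D / ?V)"
      unfolding spectral_gap_def by (intro INF_lower2[of g]) auto
    then have "ereal \<gamma> \<le> ereal (?D / ?V)" by (rule order_trans[OF \<gamma>(2)])
    then have *: "\<gamma> \<le> ?D / ?V" by (simp only: ereal_less_eq)
    have "0 \<le> ?V" by (rule measure_pmf.variance_positive)
    moreover have "?V \<noteq> 0"
    proof
      assume "?V = 0"
      with * have "\<gamma> \<le> 0" by (simp only: div_by_0) \<comment> \<open>the quotient has the junk value 0\<close>
      with \<gamma>(1) show False by simp
    qed
    ultimately have "0 < ?V" by (simp only: less_le) simp
    then show ?thesis using * by (simp only: pos_le_divide_eq)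
  qed
qed

section \<open>Size of the box and exponential weights\<close>

lemma card_site_box_le: "card (site_box n :: (int ^ 'd::finite) set) \<le> n ^ CARD('d)"
proof -
  have "(site_box n :: (int ^ 'd) set) \<subseteq> vec_lambda ` PiE UNIV (\<lambda>_. {1..int n})"
  proof
    fix x :: "int ^ 'd" assume "x \<in> site_box n"
    then have "vec_nth x \<in> PiE UNIV (\<lambda>_. {1..int n})" by (auto simp: site_box_def)
    then show "x \<in> vec_lambda ` PiE UNIV (\<lambda>_. {1..int n})"
      by (metis image_eqI vec_nth_inverse)
  qed
  then have "card (site_box n :: (int ^ 'd) set)
      \<le> card (vec_lambda ` PiE UNIV (\<lambda>_. {1..int n}) :: (int ^ 'd) set)"
    by (intro card_mono finite_imageI finite_PiE) auto
  also have "\<dots> \<le> card (PiE (UNIV :: 'd set) (\<lambda>_. {1..int n}))"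
    by (intro card_image_le finite_PiE) auto
  finally show ?thesis by (simp add: card_PiE)
qed

definition emb :: "int ^ 'd::finite \<Rightarrow> real ^ 'd" where
  "emb x = (\<chi> i. real_of_int (x $ i))"

lemma emb_add: "emb (x + y) = emb x + emb y"
  by (simp add: emb_def vec_eq_iff)

lemma sum_UN_le:
  fixes w :: "'b \<Rightarrow> real"
  assumes "finite I" "\<And>i. i \<in> I \<Longrightarrow> finite (K i)" "\<And>x. 0 \<le> w x"
  shows "(\<Sum>x\<in>(\<Union>i\<in>I. K i). w x) \<le> (\<Sum>i\<in>I. \<Sum>x\<in>K i. w x)"
  using assms
proof (induction I rule: finite_induct)
  case (insert i I)
  have fin: "finite (K i)" "finite (\<Union>i\<in>I. K i)" using insert by auto
  have "sum w (K i \<union> (\<Union>i\<in>I. K i)) \<le> sum w (K i) + sum w (\<Union>i\<in>I. K i)"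
    unfolding sum_Un[OF fin] by (simp add: sum_nonneg insert.prems)
  then show ?case using insert by (simp add: insert.hyps)
qed simp

text \<open>A past cone is covered by the closed past cones of the first steps \<open>x + u\<close>.
  Each of these carries at most \<open>1 + \<epsilon>\<close> times the weight at
  \<open>x + u\<close>, which is smaller than that at \<open>x\<close> by the factor
  \<open>exp (- \<kappa> * \<delta>)\<close>. The condition on \<open>\<epsilon>\<close> closes this
  recursion.\<close>

lemma past_cone_weight_le:
  fixes h :: "int ^ 'd::finite \<Rightarrow> real"
  assumes fin: "finite (\<Union>\<U>)" and \<delta>: "0 < \<delta>" "\<And>x u. u \<in> \<Union>\<U> \<Longrightarrow> h (x + u) \<le> h x - \<delta>"
    and \<kappa>: "0 \<le> \<kappa>" and \<epsilon>: "0 \<le> \<epsilon>" "real (card (\<Union>\<U>)) * exp (- \<kappa> * \<delta>) * (1 + \<epsilon>) \<le> \<epsilon>"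
  shows "(\<Sum>z\<in>past_cone \<U> n x. exp (\<kappa> * h z)) \<le> \<epsilon> * exp (\<kappa> * h x)"
proof -
  have hd: "h (w + u) < h w" if "u \<in> \<Union>\<U>" for w u using \<delta>(1) \<delta>(2)[OF that, of w] by linarith
  obtain L where L: "\<And>z. z \<in> site_box n \<Longrightarrow> L \<le> h z"
    using bdd_below_finite[OF finite_imageI[OF finite_site_box[of n]], of h]
    unfolding bdd_below_def by blast
  \<comment> \<open>The induction counts drops by \<open>\<delta>\<close> down to the lower bound
    \<open>L\<close> for heights in the box; at or below \<open>L\<close> the cone is empty.\<close>
  have "(\<Sum>z\<in>past_cone \<U> n x. exp (\<kappa> * h z)) \<le> \<epsilon> * exp (\<kappa> * h x)" if "h x \<le> L + real k * \<delta>" for k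
    using that
  proof (induction k arbitrary: x)
    case 0
    have "past_cone \<U> n x = {}"
    proof (rule equals0I)
      fix z assume z: "z \<in> past_cone \<U> n x"
      then have "L \<le> h z" using L past_cone_subset by blast
      then show False using past_cone_decreasing[where h = h, OF hd z] 0 by simp
    qed
    then show ?case using \<epsilon>(1) by simp
  next
    case (Suc k)
    let ?w = "\<lambda>z. exp (\<kappa> * h z)" and ?K = "\<lambda>u. insert (x + u) (past_cone \<U> n (x + u))"
    have finK: "finite (past_cone \<U> n y)" for y
      using finite_subset[OF past_cone_subset finite_site_box] .
    have finU: "finite (\<Union>u\<in>\<Union>\<U>. ?K u)"
      by (rule finite_UN_I[OF fin]) (simp add: finK)
    have sub: "past_cone \<U> n x \<subseteq> (\<Union>u\<in>\<Union>\<U>. ?K u)"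
    proof
      fix z assume z: "z \<in> past_cone \<U> n x"
      then have "(x, z) \<in> {(a, a + u) | a u. u \<in> \<Union>\<U>}\<^sup>+" by (simp add: past_cone_def)
      then obtain y where y: "(x, y) \<in> {(a, a + u) | a u. u \<in> \<Union>\<U>}" "(y, z) \<in> {(a, a + u) | a u. u \<in> \<Union>\<U>}\<^sup>*"
        by (meson tranclD)
      then obtain u where u: "u \<in> \<Union>\<U>" "y = x + u" by blast
      have "z \<in> ?K u" using y(2) u(2) z by (auto simp: past_cone_def rtrancl_eq_or_trancl)
      then show "z \<in> (\<Union>u\<in>\<Union>\<U>. ?K u)" using u(1) by blast
    qed
    have "(\<Sum>z\<in>past_cone \<U> n x. ?w z) \<le> (\<Sum>z\<in>(\<Union>u\<in>\<Union>\<U>. ?K u). ?w z)"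
      by (intro sum_mono2 sub finU) simp
    also have "\<dots> \<le> (\<Sum>u\<in>\<Union>\<U>. \<Sum>z\<in>?K u. ?w z)"
      by (rule sum_UN_le[OF fin]) (simp_all add: finK)
    also have "\<dots> \<le> (\<Sum>u\<in>\<Union>\<U>. exp (- \<kappa> * \<delta>) * (1 + \<epsilon>) * ?w x)"
    proof (rule sum_mono)
      fix u assume u: "u \<in> \<Union>\<U>"
      have "x + u \<notin> past_cone \<U> n (x + u)" using past_cone_decreasing[where h = h and z = "x + u" and x = "x + u", OF hd] by blast
      then have "(\<Sum>z\<in>?K u. ?w z) = ?w (x + u) + (\<Sum>z\<in>past_cone \<U> n (x + u). ?w z)"
        by (simp add: finK)
      also have "\<dots> \<le> ?w (x + u) + \<epsilon> * ?w (x + u)"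
        using Suc.prems \<delta>(2)[OF u, of x] by (intro add_left_mono Suc.IH) (simp add: algebra_simps)
      also have "\<dots> = (1 + \<epsilon>) * ?w (x + u)" by (simp add: algebra_simps)
      also have "\<dots> \<le> (1 + \<epsilon>) * (exp (- \<kappa> * \<delta>) * ?w x)"
      proof (rule mult_left_mono)
        have "\<kappa> * h (x + u) \<le> \<kappa> * (h x - \<delta>)" by (rule mult_left_mono[OF \<delta>(2)[OF u] \<kappa>])
        then show "?w (x + u) \<le> exp (- \<kappa> * \<delta>) * ?w x"
          by (simp add: exp_add[symmetric] algebra_simps)
      qed (use \<epsilon>(1) in simp)
      finally show "(\<Sum>z\<in>?K u. ?w z) \<le> exp (- \<kappa> * \<delta>) * (1 + \<epsilon>) * ?w x"
        by (simp add: ac_simps)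
    qed
    also have "\<dots> = (real (card (\<Union>\<U>)) * exp (- \<kappa> * \<delta>) * (1 + \<epsilon>)) * ?w x" by simp
    also have "\<dots> \<le> \<epsilon> * ?w x" by (rule mult_right_mono[OF \<epsilon>(2)]) simp
    finally show ?case .
  qed
  moreover obtain k where "(h x - L) / \<delta> \<le> real k" using real_arch_simple by blast
  then have "h x \<le> L + real k * \<delta>" using \<delta>(1) by (simp add: field_simps)
  ultimately show ?thesis by blast
qed

lemma power_div_exp_small:
  fixes c :: real
  assumes "0 < c" "0 < \<epsilon>"
  shows "\<forall>\<^sub>F n in sequentially. C * (real n ^ d * exp (- c * real n)) < \<epsilon>"
proof -
  have "filterlim (\<lambda>n. c * real n) at_top sequentially"
    using assms(1) by (intro filterlim_tendsto_pos_mult_at_top[OF tendsto_const] filterlim_real_sequentially)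
  from filterlim_compose[OF tendsto_power_div_exp_0 this]
  have "(\<lambda>n. C / c ^ d * ((c * real n) ^ d / exp (c * real n))) \<longlonglongrightarrow> C / c ^ d * 0"
    by (intro tendsto_mult tendsto_const)
  then have "\<forall>\<^sub>F n in sequentially. C / c ^ d * ((c * real n) ^ d / exp (c * real n)) < \<epsilon>"
    using assms(2) by (simp add: order_tendstoD(2))
  then show ?thesis
    using assms(1) by (simp add: power_mult_distrib exp_minus field_simps)
qed

section \<open>Linear upper bound\<close>

lemma mixing_time_upper_bound:
  fixes \<U> :: "(int ^ 'd::finite) set set"
  assumes fam: "update_family \<U>" and ori: "oriented \<U>" and q: "0 < q" "q < 1"
    and gap: "(INF n\<in>{1..}. spectral_gap \<U> q n) > 0"
  obtains C where "0 < C" "\<And>\<epsilon>. 0 < \<epsilon> \<Longrightarrow> \<forall>\<^sub>F n in sequentially. mixing_time \<U> q n \<epsilon> \<le> ereal (C * real n)"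
proof -
  have fin: "finite (\<Union>\<U>)" and ne: "\<Union>\<U> \<noteq> {}" using fam by (auto simp: update_family_def)
  obtain v where v: "norm v = 1" "\<And>u. u \<in> \<Union>\<U> \<Longrightarrow> emb u \<bullet> v < 0"
    using ori unfolding oriented_def emb_def by blast
  define h where "h x = emb x \<bullet> v" for x
  have h_add: "h (x + y) = h x + h y" for x y by (simp add: h_def emb_add inner_add_left)
  define \<delta> where "\<delta> = - Max (h ` \<Union>\<U>)"
  have "Max (h ` \<Union>\<U>) \<in> h ` \<Union>\<U>" using fin ne by (intro Max_in) auto
  then have \<delta>0: "0 < \<delta>" using v(2) unfolding \<delta>_def h_def by force
  have \<delta>: "h (x + u) \<le> h x - \<delta>" if "u \<in> \<Union>\<U>" for x u
    using Max_ge[of "h ` \<Union>\<U>" "h u"] fin that by (simp add: h_add \<delta>_def)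
  obtain \<gamma>' where \<gamma>': "0 < ereal \<gamma>'" "ereal \<gamma>' < (INF n\<in>{1..}. spectral_gap \<U> q n)"
    using ereal_dense2[OF gap] by blast
  \<comment> \<open>Capping at 1 keeps the rates \<open>vol - \<gamma> / 2\<close> and
    \<open>vol - \<gamma> / 4\<close> nonnegative on a nonempty box.\<close>
  define \<gamma> where "\<gamma> = min \<gamma>' 1"
  have \<gamma>: "0 < \<gamma>" "\<gamma> \<le> 1" using \<gamma>'(1) by (auto simp: \<gamma>_def)
  have poin: "poincare \<U> q n \<gamma>" if "1 \<le> n" for n
  proof (rule poincare_of_spectral_gap[OF \<gamma>(1)])
    have "ereal \<gamma> \<le> ereal \<gamma>'" by (simp add: \<gamma>_def)
    also have "\<dots> \<le> spectral_gap \<U> q n"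
      using \<gamma>'(2) that by (intro order.trans[OF less_imp_le INF_lower]) auto
    finally show "ereal \<gamma> \<le> spectral_gap \<U> q n" .
  qed
  define m where "m = real (card (\<Union>\<U>))"
  have m: "1 \<le> m" using fin ne by (simp add: m_def Suc_le_eq card_gt_0_iff)
  \<comment> \<open>Solves \<open>m * exp (- \<kappa> * \<delta>) * (1 + \<gamma> / 4) = \<gamma> /
    4\<close>, the closing condition of the weight recursion with
    \<open>\<epsilon> = \<gamma> / 4\<close>.\<close>
  define \<kappa> where "\<kappa> = ln (m * (1 + \<gamma> / 4) / (\<gamma> / 4)) / \<delta>"
  have arg: "1 \<le> m * (1 + \<gamma> / 4) / (\<gamma> / 4)"
  proof -
    have "1 * (1 + \<gamma> / 4) \<le> m * (1 + \<gamma> / 4)" using m \<gamma> by (intro mult_right_mono) auto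
    then show ?thesis using \<gamma> by (simp add: field_simps)
  qed
  have \<kappa>0: "0 \<le> \<kappa>" using arg \<delta>0 by (simp add: \<kappa>_def)
  have \<kappa>: "m * exp (- \<kappa> * \<delta>) * (1 + \<gamma> / 4) \<le> \<gamma> / 4"
  proof -
    define P where "P = m * (1 + \<gamma> / 4)"
    have P: "0 < P" using m \<gamma> by (simp add: P_def)
    have "exp (\<kappa> * \<delta>) = P / (\<gamma> / 4)" using arg \<delta>0 by (simp add: \<kappa>_def P_def)
    then have "exp (- \<kappa> * \<delta>) = (\<gamma> / 4) / P" by (simp add: exp_minus)
    moreover have "m * exp (- \<kappa> * \<delta>) * (1 + \<gamma> / 4) = P * exp (- \<kappa> * \<delta>)" by (simp add: P_def)
    ultimately show ?thesis using P by simp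
  qed
  define s where "s = real CARD('d)"
  have h_bound: "\<bar>h x\<bar> \<le> s * real n" if x: "x \<in> site_box n" for x n
  proof -
    have "\<bar>h x\<bar> \<le> norm (emb x) * norm v" unfolding h_def by (rule Cauchy_Schwarz_ineq2)
    also have "\<dots> \<le> (\<Sum>i\<in>UNIV. \<bar>emb x $ i\<bar>)" using norm_le_l1_cart[of "emb x"] v(1) by simp
    also have "\<dots> \<le> (\<Sum>i\<in>(UNIV :: 'd set). real n)"
      using x by (intro sum_mono) (auto simp: emb_def site_box_def; smt (verit) of_int_le_iff of_int_of_nat_eq of_int_1)
    finally show ?thesis by (simp add: s_def)
  qed
  \<comment> \<open>Chosen so that \<open>\<gamma> / 4 * C = 2 * \<kappa> * s + 1\<close>: the decay
    cancels the largest weight \<open>exp (2 * \<kappa> * s * n)\<close> and leaves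
    \<open>exp (- n)\<close> against the polynomial number of sites.\<close>
  define C where "C = 4 * (2 * \<kappa> * s + 1) / \<gamma>"
  have C: "0 < C" using \<kappa>0 \<gamma> by (simp add: C_def s_def add_nonneg_pos)
  have tv: "worst_tv \<U> q n (C * real n) \<le> 1 * (real n ^ CARD('d) * exp (- 1 * real n))" if n: "1 \<le> n" for n
  proof (rule worst_tv_le)
    fix \<eta> :: "'d config" and A assume \<eta>: "\<eta> \<in> configs n"
    \<comment> \<open>The shift by \<open>s * n\<close> makes every weight at least 1 on the box, as
      heights there are at least \<open>- s * n\<close>.\<close>
    define W where "W x = exp (\<kappa> * (h x + s * real n))" for x
    interpret oriented_kcm \<U> q n h \<eta> "real (card (site_box n :: (int ^ 'd) set))"
      using q \<eta> \<delta>0 \<delta> by unfold_locales (auto, smt (verit) UnionI)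
    have W1: "1 \<le> W x" if "x \<in> site_box n" for x
      using h_bound[OF that] \<kappa>0 by (simp add: W_def)
    have W2: "(\<Sum>z\<in>past_cone \<U> n x. W z) \<le> \<gamma> / 4 * W x" for x
    proof -
      have "(\<Sum>z\<in>past_cone \<U> n x. W z) = (\<Sum>z\<in>past_cone \<U> n x. exp (\<kappa> * h z)) * exp (\<kappa> * (s * real n))"
        by (simp add: W_def distrib_left exp_add sum_distrib_right)
      also have "\<dots> \<le> (\<gamma> / 4 * exp (\<kappa> * h x)) * exp (\<kappa> * (s * real n))"
        using \<gamma> \<kappa> \<delta>0 \<delta> fin \<kappa>0 by (intro mult_right_mono past_cone_weight_le[where \<delta> = \<delta>]) (auto simp: m_def)
      finally show ?thesis by (simp add: W_def distrib_left exp_add)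
    qed
    have "(\<Sum>x\<in>site_box n. W x) \<le> (\<Sum>x\<in>(site_box n :: (int ^ 'd) set). exp (2 * \<kappa> * s * real n))"
    proof (rule sum_mono)
      fix x :: "int ^ 'd" assume "x \<in> site_box n"
      then have "h x + s * real n \<le> 2 * (s * real n)" using h_bound[of x n] by linarith
      from mult_left_mono[OF this \<kappa>0] show "W x \<le> exp (2 * \<kappa> * s * real n)" by (simp add: W_def)
    qed
    also have "\<dots> = real (card (site_box n :: (int ^ 'd) set)) * exp (2 * \<kappa> * s * real n)" by simp
    also have "\<dots> \<le> real n ^ CARD('d) * exp (2 * \<kappa> * s * real n)"
      using card_site_box_le[of n, where 'd = 'd]
      by (intro mult_right_mono) (simp_all flip: of_nat_power)
    finally have sumW: "(\<Sum>x\<in>site_box n. W x) \<le> real n ^ CARD('d) * exp (2 * \<kappa> * s * real n)" .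
    have "law \<U> q n \<eta> (C * real n) A
      \<le> measure_pmf.prob (equilibrium q n) A + (\<Sum>x\<in>site_box n. W x) * exp (- (\<gamma> / 4) * (C * real n))"
      using C by (intro law_le poin n \<gamma> W1 W2) auto
    also have "(\<Sum>x\<in>site_box n. W x) * exp (- (\<gamma> / 4) * (C * real n))
        \<le> (real n ^ CARD('d) * exp (2 * \<kappa> * s * real n)) * exp (- (\<gamma> / 4) * (C * real n))"
      by (rule mult_right_mono[OF sumW]) simp
    also have "(\<gamma> / 4) * (C * real n) = (2 * \<kappa> * s + 1) * real n" using \<gamma> by (simp add: C_def)
    then have "(real n ^ CARD('d) * exp (2 * \<kappa> * s * real n)) * exp (- (\<gamma> / 4) * (C * real n))
        = 1 * (real n ^ CARD('d) * exp (- 1 * real n))"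
      by (simp add: mult.assoc exp_add[symmetric] algebra_simps)
    finally show "law \<U> q n \<eta> (C * real n) A
      \<le> measure_pmf.prob (equilibrium q n) A + 1 * (real n ^ CARD('d) * exp (- 1 * real n))" by simp
  qed (use q in auto)
  have "\<forall>\<^sub>F n in sequentially. mixing_time \<U> q n \<epsilon> \<le> ereal (C * real n)" if \<epsilon>: "0 < \<epsilon>" for \<epsilon>
    using power_div_exp_small[OF zero_less_one \<epsilon>, of 1 "CARD('d)"] eventually_ge_at_top[of 1]
  proof eventually_elim
    case (elim n)
    then have "worst_tv \<U> q n (C * real n) \<le> \<epsilon>" using tv[of n] by simp
    then show ?case unfolding mixing_time_def using C by (intro INF_lower) simp
  qed
  with C that show thesis by blast
qed

section \<open>Linear lower bound\<close>

lemma mixing_time_lower_bound: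
  fixes \<U> :: "(int ^ 'd::finite) set set"
  assumes fam: "update_family \<U>" and q: "0 < q" "q < 1"
  obtains C where "0 < C" "\<And>\<epsilon>. \<epsilon> < 1 \<Longrightarrow> \<forall>\<^sub>F n in sequentially. ereal (real n / C) \<le> mixing_time \<U> q n \<epsilon>"
proof -
  have fin: "finite (\<Union>\<U>)" and ne: "\<And>U. U \<in> \<U> \<Longrightarrow> U \<noteq> {}" and ne': "\<Union>\<U> \<noteq> {}"
    using fam by (auto simp: update_family_def)
  define R where "R = Max ((\<lambda>u. norm (emb u)) ` \<Union>\<U>)"
  have R: "norm (emb u) \<le> R" if "u \<in> \<Union>\<U>" for u
    unfolding R_def using fin that by (intro Max_ge) auto
  define M where "M = real (card (\<Union>\<U>)) * exp R"
  have M: "0 < M" using fin ne' by (simp add: M_def card_gt_0_iff)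
  have "\<forall>\<^sub>F n in sequentially. ereal (real n / (4 * M)) \<le> mixing_time \<U> q n \<epsilon>" if \<epsilon>: "\<epsilon> < 1" for \<epsilon>
  proof -
    have "(\<lambda>m. (1 - q) ^ m) \<longlonglongrightarrow> 0" using q by (intro LIMSEQ_realpow_zero) auto
    then have "\<forall>\<^sub>F m in sequentially. (1 - q) ^ m < (1 - \<epsilon>) / 2"
      using \<epsilon> by (intro order_tendstoD(2)) auto
    \<comment> \<open>In equilibrium, \<open>m\<close> given sites are all 1 with probability
      \<open>(1 - q) ^ m\<close>. Only \<open>m\<close> and the threshold for \<open>n\<close>
      depend on \<open>\<epsilon>\<close>; the speed constant \<open>4 * M\<close> does not.\<close>
    then obtain m where m: "(1 - q) ^ m < (1 - \<epsilon>) / 2"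
      by (auto simp: eventually_sequentially)
    have "\<forall>\<^sub>F n in sequentially. exp (2 + real m) * (real n ^ CARD('d) * exp (- (1 / 4) * real n)) < (1 - \<epsilon>) / 2"
      using \<epsilon> by (intro power_div_exp_small) auto
    then show ?thesis
      using eventually_ge_at_top[of "2 * m + 2"]
    proof eventually_elim
      case (elim n)
      define x0 :: "int ^ 'd" where "x0 = (\<chi> i. int (n div 2))"
      \<comment> \<open>The weight decays at unit rate away from the centre. One step therefore
        changes it by a factor of at most \<open>exp R\<close>, and it is exponentially small near
        the boundary.\<close>
      define a where "a y = exp (- norm (emb y - emb x0))" for y
      obtain j :: 'd where True by blast
      define p where "p k = x0 + (\<chi> i. if i = j then int k else 0)" for k :: nat
      \<comment> \<open>A row of \<open>m\<close> sites from the centre along one axis;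
        \<open>2 * m + 2 \<le> n\<close> keeps it inside the box.\<close>
      define B where "B = p ` {..<m}"
      \<comment> \<open>At most \<open>n ^ d\<close> sites, each of boundary weight. The loss of 2
        allows 1 for rounding in \<open>n div 2\<close> and 1 for coordinates starting at 1.\<close>
      define b where "b = real n ^ CARD('d) * exp (- (real n / 2 - 2 - R))"
      let ?E = "{\<eta> \<in> configs n. \<exists>y\<in>B. \<not> \<eta> y}" and ?s = "\<lambda>y :: int ^ 'd. y \<in> site_box n"
      have s: "?s \<in> configs n" by (simp add: configs_def PiE_dflt_def)
      have n: "2 * m + 2 \<le> n" by fact
      have inj: "inj_on p {..<m}"
        by (rule inj_onI) (auto simp: p_def vec_eq_iff split: if_splits)
      have B: "B \<subseteq> site_box n"
        using n by (auto simp: B_def p_def x0_def site_box_def)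
      have aB: "exp (- real m) \<le> a y" if yB: "y \<in> B" for y
      proof -
        obtain k where k: "k < m" "y = p k" using yB unfolding B_def by blast
        have "emb y - emb x0 = real k *\<^sub>R axis j 1"
          by (auto simp: k p_def emb_def vec_eq_iff axis_def)
        then show ?thesis using k(1) by (simp add: a_def)
      qed
      have a_step: "a y \<le> exp R * a (y + u)" if "u \<in> \<Union>\<U>" for y u
      proof -
        have "norm (emb (y + u) - emb x0) \<le> norm (emb y - emb x0) + norm (emb u)"
          using norm_triangle_ineq[of "emb y - emb x0" "emb u"] by (simp add: emb_add algebra_simps)
        then have "- norm (emb y - emb x0) \<le> R - norm (emb (y + u) - emb x0)"
          using R[OF that] by linarith
        then show ?thesis by (simp add: a_def exp_add[symmetric])
      qed
      have boundary: "(\<Sum>y\<in>{y \<in> site_box n. y + u \<notin> site_box n}. a y) \<le> b" if u: "u \<in> \<Union>\<U>" for u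
      proof -
        have far: "a y \<le> exp (- (real n / 2 - 2 - R))" if y: "y \<in> site_box n" "y + u \<notin> site_box n" for y
        proof -
          obtain i where i: "y $ i + u $ i < 1 \<or> int n < y $ i + u $ i"
            using y(2) by (auto simp: site_box_def not_le)
          have "\<bar>real_of_int (u $ i)\<bar> \<le> R"
            using component_le_norm_cart[of "emb u" i] R[OF u] by (simp add: emb_def)
          moreover have "\<bar>real_of_int (y $ i) - real (n div 2)\<bar> \<le> norm (emb y - emb x0)"
            using component_le_norm_cart[of "emb y - emb x0" i] by (simp add: emb_def x0_def)
          moreover have "real n / 2 - 1 \<le> real (n div 2)" "real (n div 2) \<le> real n / 2"
            by linarith+
          moreover have "real_of_int (y $ i) + real_of_int (u $ i) < 1
              \<or> real n < real_of_int (y $ i) + real_of_int (u $ i)"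
            using i by linarith
          ultimately have "real n / 2 - 2 - R \<le> norm (emb y - emb x0)" by linarith
          then show ?thesis by (simp add: a_def)
        qed
        have "(\<Sum>y\<in>{y \<in> site_box n. y + u \<notin> site_box n}. a y)
            \<le> (\<Sum>y\<in>(site_box n :: (int ^ 'd) set). exp (- (real n / 2 - 2 - R)))"
          by (rule order_trans[OF sum_mono[OF far] sum_mono2]) (auto simp: finite_site_box)
        also have "\<dots> \<le> b"
          using card_site_box_le[of n, where 'd = 'd] unfolding b_def sum_constant
          by (intro mult_right_mono) (simp_all flip: of_nat_power)
        finally show ?thesis .
      qed
      \<comment> \<open>For such \<open>t\<close> the growth \<open>exp (M * t)\<close> is at most
        \<open>exp (n / 4)\<close>, while the boundary weight is of order
        \<open>exp (- n / 2)\<close>; \<open>exp (- n / 4)\<close> is left to beat the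
        polynomial.\<close>
      have law: "law \<U> q n ?s t ?E < (1 - \<epsilon>) / 2" if t: "0 \<le> t" "t < real n / (4 * M)" for t
      proof -
        have "law \<U> q n ?s t ?E \<le> b / (exp R * exp (- real m)) * exp (real (card (\<Union>\<U>)) * exp R * t)"
          using q t boundary B aB a_step fin ne
          by (intro law_some_zero_le[where a = a and B = B]) (auto simp: a_def b_def)
        also have "\<dots> \<le> b / (exp R * exp (- real m)) * exp (real n / 4)"
        proof (rule mult_left_mono)
          have "M * t \<le> real n / 4" using t(2) M by (simp add: field_simps)
          then show "exp (real (card (\<Union>\<U>)) * exp R * t) \<le> exp (real n / 4)" by (simp add: M_def)
        qed (simp add: b_def)
        also have "\<dots> = exp (2 + real m) * (real n ^ CARD('d) * exp (- (1 / 4) * real n))"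
          by (simp add: b_def exp_add[symmetric] exp_diff[symmetric] field_simps)
        also have "\<dots> < (1 - \<epsilon>) / 2" by fact
        finally show ?thesis .
      qed
      have prob: "measure_pmf.prob (equilibrium q n) ?E = 1 - (1 - q) ^ m"
      proof -
        let ?P = "measure_pmf.prob (equilibrium q n :: 'd config pmf)"
        let ?F = "PiE_dflt (site_box n) False (\<lambda>y. if y \<in> B then {True} else UNIV)"
        have "?P ?F = (\<Prod>y\<in>site_box n. measure_pmf.prob (bernoulli_pmf (1 - q)) (if y \<in> B then {True} else UNIV))"
          unfolding equilibrium_def by (rule measure_Pi_pmf_PiE_dflt[OF finite_site_box])
        also have "\<dots> = (\<Prod>y\<in>site_box n. if y \<in> B then 1 - q else 1)"
          using q by (intro prod.cong) (auto simp: measure_pmf_single)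
        also have "\<dots> = (\<Prod>y\<in>site_box n \<inter> B. 1 - q)"
          by (rule prod.inter_restrict[OF finite_site_box, symmetric])
        also have "site_box n \<inter> B = B" using B by blast
        also have "(\<Prod>y\<in>B. 1 - q) = (1 - q) ^ card B" by simp
        also have "\<dots> = (1 - q) ^ m"
          using inj by (simp only: B_def card_image card_lessThan)
        finally have F: "?P ?F = (1 - q) ^ m" .
        have C1: "?P (configs n) = 1"
          using set_equilibrium[of q n, where 'd = 'd]
          by (auto simp: measure_pmf.prob_eq_1 AE_measure_pmf_iff)
        have sub: "?F \<subseteq> configs n" by (auto simp: configs_def PiE_dflt_def)
        have "?E = configs n - ?F"
          using B by (auto simp: configs_def PiE_dflt_def split: if_splits)
        then have "?P ?E = ?P (configs n) - ?P ?F"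
          using sub by (simp add: measure_pmf.finite_measure_Diff)
        then show ?thesis by (simp add: F C1)
      qed
      show ?case
        unfolding mixing_time_def
      proof (rule INF_greatest)
        fix t assume "t \<in> {t. 0 \<le> t \<and> worst_tv \<U> q n t \<le> \<epsilon>}"
        then have t: "0 \<le> t" "worst_tv \<U> q n t \<le> \<epsilon>" by auto
        \<comment> \<open>Before this time a zero in \<open>B\<close> has probability below
          \<open>(1 - \<epsilon>) / 2\<close>, whereas in equilibrium it exceeds
          \<open>1 - (1 - \<epsilon>) / 2\<close>; the gap is larger than
          \<open>\<epsilon>\<close>.\<close>
        have "\<not> t < real n / (4 * M)"
        proof
          assume "t < real n / (4 * M)"
          then have "law \<U> q n ?s t ?E < (1 - \<epsilon>) / 2" using t(1) by (rule law[rotated])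
          moreover have "\<bar>law \<U> q n ?s t ?E - measure_pmf.prob (equilibrium q n) ?E\<bar> \<le> worst_tv \<U> q n t"
            by (rule worst_tv_ge[OF s]) auto
          then have "1 - (1 - q) ^ m - law \<U> q n ?s t ?E \<le> \<epsilon>"
            unfolding prob using t(2) by linarith
          ultimately show False using m by (simp add: field_simps)
        qed
        then show "ereal (real n / (4 * M)) \<le> ereal t" by simp
      qed
    qed
  qed
  then show thesis using M by (intro that[of "4 * M"]) auto
qed

theorem theorem2p4:
  fixes \<U> :: "(int ^ 'd::finite) set set" and q :: real
  assumes "update_family \<U>" and "oriented \<U>"
    and "0 < q" and "q < 1"
    and "(INF n\<in>{1..}. spectral_gap \<U> q n) > 0"
  shows "pre_cutoff (mixing_time \<U> q) \<and>
         (\<exists>C::real. C \<ge> 1 \<and>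
            (\<forall>\<epsilon>::real. 0 < \<epsilon> \<and> \<epsilon> < 1 \<longrightarrow>
               (\<forall>\<^sub>F n in sequentially.
                  ereal (inverse C * real n) \<le> mixing_time \<U> q n \<epsilon> \<and>
                  mixing_time \<U> q n \<epsilon> \<le> ereal (C * real n))))"
proof -
  obtain C1 where C1: "0 < C1"
    "\<And>\<epsilon>. 0 < \<epsilon> \<Longrightarrow> \<forall>\<^sub>F n in sequentially. mixing_time \<U> q n \<epsilon> \<le> ereal (C1 * real n)"
    using mixing_time_upper_bound[OF assms] by blast
  obtain C2 where C2: "0 < C2"
    "\<And>\<epsilon>. \<epsilon> < 1 \<Longrightarrow> \<forall>\<^sub>F n in sequentially. ereal (real n / C2) \<le> mixing_time \<U> q n \<epsilon>"
    using mixing_time_lower_bound[OF assms(1,3,4)] by blast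
  define C where "C = max 1 (max C1 C2)"
  have C: "1 \<le> C" "C1 \<le> C" "C2 \<le> C" by (auto simp: C_def)
  have bounds: "\<forall>\<^sub>F n in sequentially. ereal (inverse C * real n) \<le> mixing_time \<U> q n \<epsilon> \<and>
      mixing_time \<U> q n \<epsilon> \<le> ereal (C * real n)" if "0 < \<epsilon>" "\<epsilon> < 1" for \<epsilon>
    using C1(2)[OF that(1)] C2(2)[OF that(2)]
  proof eventually_elim
    case (elim n)
    have "inverse C * real n \<le> real n / C2"
      using C C2(1) by (simp add: divide_inverse mult.commute[of _ "real n"] le_imp_inverse_le mult_left_mono)
    then have "ereal (inverse C * real n) \<le> ereal (real n / C2)" by simp
    moreover have "ereal (C1 * real n) \<le> ereal (C * real n)"
      using C by (simp add: mult_right_mono)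
    ultimately show ?case using elim order_trans by blast
  qed
  have "limsup (\<lambda>n. mixing_time \<U> q n \<epsilon> / mixing_time \<U> q n (1 - \<epsilon>)) \<le> ereal (C * C)"
    if \<epsilon>: "\<epsilon> \<in> {0<..<1/2}" for \<epsilon>
  proof (rule Limsup_bounded)
    have e: "0 < \<epsilon>" "\<epsilon> < 1" "0 < 1 - \<epsilon>" "1 - \<epsilon> < 1" using \<epsilon> by auto
    show "\<forall>\<^sub>F n in sequentially. mixing_time \<U> q n \<epsilon> / mixing_time \<U> q n (1 - \<epsilon>) \<le> ereal (C * C)"
      using bounds[OF e(1,2)] bounds[OF e(3,4)] eventually_ge_at_top[of 1]
    proof eventually_elim
      case (elim n)
      \<comment> \<open>The linear bounds at \<open>\<epsilon>\<close> and
        \<open>1 - \<epsilon>\<close> make both times finite and the denominator positive, so the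
        extended quotient is an ordinary one. Since \<open>C\<close> serves both, the ratio is at
        most \<open>C * C\<close>.\<close>
      obtain x where x: "mixing_time \<U> q n \<epsilon> = ereal x" "x \<le> C * real n"
        using elim by (cases "mixing_time \<U> q n \<epsilon>") auto
      obtain y where y: "mixing_time \<U> q n (1 - \<epsilon>) = ereal y" "inverse C * real n \<le> y"
        using elim by (cases "mixing_time \<U> q n (1 - \<epsilon>)") auto
      have "0 < inverse C * real n" using C(1) elim(3) by simp
      then have y0: "0 < y" using y(2) by linarith
      have "x \<le> C * (C * (inverse C * real n))" using x(2) C(1) by (simp add: field_simps)
      also have "\<dots> \<le> C * (C * y)" using y(2) C(1) by (intro mult_left_mono) auto
      finally have "x / y \<le> C * C" using y0 by (simp add: field_simps)
      then show ?case using y0 by (simp add: x y)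
    qed
  qed
  then have "(SUP \<epsilon>\<in>{0<..<1/2}. limsup (\<lambda>n. mixing_time \<U> q n \<epsilon> / mixing_time \<U> q n (1 - \<epsilon>))) \<le> ereal (C * C)"
    by (rule SUP_least)
  then have "pre_cutoff (mixing_time \<U> q)"
    unfolding pre_cutoff_def by (rule le_less_trans) simp
  with bounds C(1) show ?thesis by blast
qed

end
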